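(* Let $G$ be a unicyclic graph of order $n\geq 6$. Then $ABC_3(G)\leq n\sqrt{\tfrac12}$, with equality if and only if $G\cong H(n,3;n_1,n_2,n_3)$ for some nonnegative integers $n_1,n_2,n_3$ with $n_1+n_2+n_3=n-3$, or $G\cong H(n,4;n-4,0,0,0)$.
   Context: All graphs are simple and connected. For a vertex $u$ of a graph $G$, the eccentricity $e_G(u)$ is $\max\{d_G(u,v): v\in V(G)\}$, where $d_G$ is the shortest-path distance. $ABC_3(G)=\sum_{uv\in E(G)}\sqrt{\frac{e_G(u)+e_G(v)-2}{e_G(u)e_G(v)}}$. A unicyclic graph is a connected graph with exactly one cycle. For nonnegative integers $n_1,\ldots,n_k$ with $\sum_i n_i=n-k$, $H(n,k;n_1,\ldots,n_k)$ is the unicyclic graph of order $n$ obtained from the cycle $C_k=v_1v_2\cdots v_kv_1$ by attaching $n_i$ new pendent vertices to $v_i$ for each $i=1,\ldots,k$. *)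

theory Defs
  imports Complex_Main "Graph_Theory.Graph_Theory"
begin

text \<open>
  A finite simple graph is a \<^locale>\<open>pair_graph\<close>: a finite, symmetric, loop-free digraph
  whose arcs are pairs of vertices. Each undirected edge \<open>uv\<close> thus appears as the two arcs
  \<open>(u, v)\<close> and \<open>(v, u)\<close>.
\<close>

definition edges :: "'a pair_pre_digraph \<Rightarrow> 'a set set" where
  "edges G = (\<lambda>(u, v). {u, v}) ` parcs G"

text \<open>Shortest-path distance: the library's shortest-path cost for unit arc weights.\<close>

definition gdist :: "'a pair_pre_digraph \<Rightarrow> 'a \<Rightarrow> 'a \<Rightarrow> real" where
  "gdist G u v = real_of_ereal (wf_digraph.\<mu> (with_proj G) (\<lambda>_. 1) u v)"

definition ecc :: "'a pair_pre_digraph \<Rightarrow> 'a \<Rightarrow> real" where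
  "ecc G u = Max {gdist G u v | v. v \<in> pverts G}"

text \<open>An edge \<open>e\<close> is a two-element set, so the sum and product over \<open>e\<close> range over its two ends.\<close>

definition ABC3 :: "'a pair_pre_digraph \<Rightarrow> real" where
  "ABC3 G = (\<Sum>e\<in>edges G. sqrt (((\<Sum>u\<in>e. ecc G u) - 2) / (\<Prod>u\<in>e. ecc G u)))"

text \<open>
  \<^const>\<open>pre_digraph.cycle\<close> admits the closed walk \<open>u, v, u\<close>, which is excluded here by the
  length bound. A cycle as a subgraph is identified with its set of undirected edges, so that
  choice of starting vertex and direction do not matter.
\<close>

definition cycles :: "'a pair_pre_digraph \<Rightarrow> 'a set set set" where
  "cycles G = {(\<lambda>(u, v). {u, v}) ` set p | p. pre_digraph.cycle (with_proj G) p \<and> 3 \<le> length p}"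

definition unicyclic :: "'a pair_pre_digraph \<Rightarrow> bool" where
  "unicyclic G \<longleftrightarrow> Digraph_Component.connected (with_proj G) \<and> (\<exists>!C. C \<in> cycles G)"

text \<open>
  \<open>H_graph [n\<^sub>1, \<dots>, n\<^sub>k]\<close> is \<open>H(n, k; n\<^sub>1, \<dots>, n\<^sub>k)\<close> with \<open>n = k + n\<^sub>1 + \<dots> + n\<^sub>k\<close>, for \<open>k \<ge> 3\<close>.
  The cycle vertex \<open>v\<^sub>i\<^sub>+\<^sub>1\<close> is \<open>(i, 0)\<close>, and the pendent vertices attached to it are
  \<open>(i, 1), \<dots>, (i, n\<^sub>i\<^sub>+\<^sub>1)\<close>.
\<close>

definition H_graph :: "nat list \<Rightarrow> (nat \<times> nat) pair_pre_digraph" where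
  "H_graph ns = \<lparr>
     pverts = {(i, j). i < length ns \<and> j \<le> ns ! i},
     parcs = symcl ({((i, 0), (Suc i mod length ns, 0)) | i. i < length ns} \<union>
                    {((i, 0), (i, j)) | i j. i < length ns \<and> 1 \<le> j \<and> j \<le> ns ! i}) \<rparr>"

lemma card_pverts_H_graph: "card (pverts (H_graph ns)) = length ns + sum_list ns"
proof -
  have "pverts (H_graph ns) = (SIGMA i:{..<length ns}. {..ns ! i})"
    by (auto simp: H_graph_def)
  then show ?thesis
    by (simp add: sum_list_sum_nth sum.distrib sum_Suc atLeast0LessThan)
qed

lemma pair_graph_H_graph:
  assumes "3 \<le> length ns"
  shows "pair_graph (H_graph ns)"
proof -
  let ?H = "H_graph ns"
  have V: "pverts ?H = (SIGMA i:{..<length ns}. {..ns ! i})"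
    by (auto simp: H_graph_def)
  have A: "parcs ?H \<subseteq> pverts ?H \<times> pverts ?H"
    using assms by (auto simp: H_graph_def symcl_def intro!: mod_less_divisor)
  have fin: "finite (pverts ?H)"
    by (simp add: V)
  have ne: "Suc i mod length ns \<noteq> i" if "i < length ns" for i
    using that assms by (cases "Suc i = length ns") auto
  have loop: "fst e \<noteq> snd e" if "e \<in> parcs ?H" for e
    using that ne by (fastforce simp: H_graph_def symcl_def)
  show ?thesis
  proof
    show "finite (parcs ?H)"
      using finite_subset[OF A] fin by blast
    show "symmetric (with_proj ?H)"
      by (auto simp: symmetric_def H_graph_def symcl_def sym_def)
  qed (use A fin loop in auto)
qed

end

theory Submission
  imports Defs
begin

text \<open>
  For adjacent vertices of eccentricities \<open>a\<close> and \<open>b\<close>, the identity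
  \<open>(a + b - 2) / (a b) = 1 / 2 - (a - 2) (b - 2) / (2 a b)\<close> and \<open>\<bar>a - b\<bar> \<le> 1\<close> show that the edge
  contributes at most \<open>sqrt (1 / 2)\<close>, with equality iff \<open>a = 2\<close> or \<open>b = 2\<close>. A breadth-first search tree
  of a unicyclic graph misses exactly one edge, because every non-tree edge closes its own cycle;
  hence there are \<open>n\<close> edges, and equality holds iff the vertices of eccentricity 2 cover all edges.

  In that case the search tree rooted at a vertex of eccentricity 2 has depth 2. The extra edge joins
  levels 1 and 1, 1 and 2, or 2 and 2, and the covering condition on the edges of the cycle confines
  the remaining vertices to pendent positions: a triangle, a 4-cycle with a single hub, or a triangle
  through the root's only neighbour (a 5-cycle would leave no room for a sixth vertex).
\<close>

section \<open>Distances and edge weights\<close>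

locale connected_pair_graph = pair_graph +
  assumes connected_G: "Digraph_Component.connected (with_proj G)"
begin

definition adj :: "'a \<Rightarrow> 'a \<Rightarrow> bool" where
  "adj u v \<longleftrightarrow> (u, v) \<in> parcs G"

text \<open>Distances as natural numbers, so that levels of a search tree admit induction and case
  analysis; \<open>gdist_hops\<close> ties them to the real-valued \<open>gdist\<close>.\<close>

definition hops :: "'a \<Rightarrow> 'a \<Rightarrow> nat" where
  "hops u v = (LEAST k. \<exists>p. awalk u p v \<and> length p = k)"

lemma adj_sym: "adj u v \<Longrightarrow> adj v u"
  by (simp add: adj_def arcs_symmetric)

lemma adj_irrefl: "\<not> adj u u"
  using no_loops' by (auto simp: adj_def)

lemma adj_in_verts: "adj u v \<Longrightarrow> u \<in> pverts G" "adj u v \<Longrightarrow> v \<in> pverts G"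
  by (auto simp: adj_def dest: wellformed')

text \<open>Connectedness is strong connectedness of the symmetric closure, and \<open>G\<close> is
  its own symmetric closure.\<close>

lemma ex_awalk:
  assumes "u \<in> pverts G" "v \<in> pverts G"
  shows "\<exists>p. awalk u p v"
proof -
  have "mk_symmetric (with_proj G) = G"
    using arcs_symmetric by (auto simp: mk_symmetric_def intro!: pair_pre_digraph.equality)
  then have "strongly_connected (with_proj G)"
    using connected_G by (simp add: Digraph_Component.connected_def)
  then have "u \<rightarrow>\<^sup>*\<^bsub>with_proj G\<^esub> v"
    using assms by auto
  then show ?thesis
    by (simp add: reachable_awalk)
qed

lemma hops_le: "awalk u p v \<Longrightarrow> hops u v \<le> length p"
  unfolding hops_def by (rule Least_le) blast

lemma hops_awalk:
  assumes "u \<in> pverts G" "v \<in> pverts G"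
  obtains p where "awalk u p v" "length p = hops u v"
  using LeastI_ex[of "\<lambda>k. \<exists>p. awalk u p v \<and> length p = k"] ex_awalk[OF assms]
  unfolding hops_def by blast

text \<open>The cost \<open>\<mu>\<close> is an infimum of walk costs. With unit weights a cost is a
  length, and the infimum is attained by a shortest walk.\<close>

lemma gdist_hops:
  assumes "u \<in> pverts G" "v \<in> pverts G"
  shows "gdist G u v = real (hops u v)"
proof -
  have cost: "awalk_cost (\<lambda>_. 1) p = real (length p)" for p
    by (induction p) auto
  obtain p where p: "awalk u p v" "length p = hops u v"
    using hops_awalk[OF assms] .
  have "\<mu> (\<lambda>_. 1) u v = ereal (real (hops u v))"
  proof (rule antisym)
    show "\<mu> (\<lambda>_. 1) u v \<le> ereal (real (hops u v))"
      using min_cost_le_walk_cost[OF p(1), of "\<lambda>_. 1"] by (simp add: cost p(2))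
    show "ereal (real (hops u v)) \<le> \<mu> (\<lambda>_. 1) u v"
      unfolding \<mu>_def by (rule INF_greatest) (simp add: cost hops_le)
  qed
  then show ?thesis
    by (simp add: gdist_def)
qed

lemma hops_0_iff:
  assumes "u \<in> pverts G" "v \<in> pverts G"
  shows "hops u v = 0 \<longleftrightarrow> u = v"
proof
  assume "hops u v = 0"
  then show "u = v"
    using hops_awalk[OF assms] by (metis awalk_Nil_iff length_0_conv)
next
  assume "u = v"
  then show "hops u v = 0"
    using hops_le[of u "[]" v] assms by (simp add: awalk_Nil_iff)
qed

lemma hops_adj:
  assumes "u \<in> pverts G" "adj v w"
  shows "hops u w \<le> Suc (hops u v)"
proof -
  obtain p where p: "awalk u p v" "length p = hops u v"
    using hops_awalk assms adj_in_verts by metis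
  then have "awalk u (p @ [(v, w)]) w"
    using assms(2) by (auto simp: adj_def awalk_simps wellformed')
  from hops_le[OF this] show ?thesis
    by (simp add: p)
qed

text \<open>Take the penultimate vertex of a shortest walk: the shortened walk bounds its distance
  from above, \<open>hops_adj\<close> from below.\<close>

lemma hops_SucE:
  assumes "u \<in> pverts G" "w \<in> pverts G" "hops u w = Suc k"
  obtains v where "adj v w" "hops u v = k"
proof -
  obtain p where p: "awalk u p w" "length p = Suc k"
    using hops_awalk[OF assms(1,2)] assms(3) by metis
  then obtain q e where q: "p = q @ [e]"
    by (metis length_Suc_conv_rev)
  then have walk: "awalk u q (fst e)" and e: "e \<in> parcs G" "snd e = w"
    using p by (auto simp: awalk_simps)
  have adj: "adj (fst e) w"
    using e by (auto simp: adj_def)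
  moreover have "hops u (fst e) = k"
    using hops_le[OF walk] hops_adj[OF assms(1) adj] assms(3) p(2) q by simp
  ultimately show thesis ..
qed

lemma hops_le_1_iff:
  assumes "u \<in> pverts G" "v \<in> pverts G"
  shows "hops u v \<le> 1 \<longleftrightarrow> u = v \<or> adj u v"
proof
  assume le: "hops u v \<le> 1"
  show "u = v \<or> adj u v"
  proof (cases "hops u v")
    case 0
    then show ?thesis
      using assms hops_0_iff by blast
  next
    case (Suc k)
    with le obtain w where w: "adj w v" "hops u w = 0"
      using hops_SucE[OF assms Suc] by auto
    then have "u = w"
      using hops_0_iff[OF assms(1)] adj_in_verts by blast
    with w show ?thesis by simp
  qed
next
  have "hops u u = 0"
    using assms hops_0_iff by blast
  moreover assume "u = v \<or> adj u v"
  ultimately show "hops u v \<le> 1"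
    using hops_adj[OF assms(1), of u v] by auto
qed

lemma hops_le_2_iff:
  assumes "u \<in> pverts G" "v \<in> pverts G"
  shows "hops u v \<le> 2 \<longleftrightarrow> u = v \<or> adj u v \<or> (\<exists>w. adj u w \<and> adj w v)"
proof
  assume le: "hops u v \<le> 2"
  show "u = v \<or> adj u v \<or> (\<exists>w. adj u w \<and> adj w v)"
  proof (cases "hops u v \<le> 1")
    case False
    then obtain w where "adj w v" "hops u w = 1"
      using le hops_SucE[OF assms, of 1] by auto
    then show ?thesis
      using hops_le_1_iff[OF assms(1), of w] adj_in_verts by auto
  qed (use assms hops_le_1_iff in auto)
next
  assume "u = v \<or> adj u v \<or> (\<exists>w. adj u w \<and> adj w v)"
  then consider "hops u v \<le> 1" | w where "adj u w" "adj w v"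
    using hops_le_1_iff[OF assms] by blast
  then show "hops u v \<le> 2"
  proof cases
    case 2
    then have "hops u w \<le> 1"
      using hops_le_1_iff assms(1) adj_in_verts by blast
    then show ?thesis
      using hops_adj[OF assms(1) 2(2)] by simp
  qed simp
qed

section \<open>Eccentricities as natural numbers\<close>

definition eccn :: "'a \<Rightarrow> nat" where
  "eccn u = Max (hops u ` pverts G)"

lemma ecc_eccn:
  assumes "u \<in> pverts G"
  shows "ecc G u = real (eccn u)"
proof -
  have "{gdist G u v | v. v \<in> pverts G} = real ` (hops u ` pverts G)"
    using assms by (force simp: gdist_hops)
  then have "ecc G u = Max (real ` (hops u ` pverts G))"
    by (simp add: ecc_def)
  also have "\<dots> = real (Max (hops u ` pverts G))"
    using assms pair_finite_verts
    by (intro mono_Max_commute[symmetric]) (auto intro: monoI)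
  finally show ?thesis
    by (simp add: eccn_def)
qed

lemma eccn_le_iff:
  assumes "u \<in> pverts G"
  shows "eccn u \<le> k \<longleftrightarrow> (\<forall>v\<in>pverts G. hops u v \<le> k)"
  unfolding eccn_def using assms pair_finite_verts by (subst Max_le_iff) auto

text \<open>Eccentricity 2 is expressed through adjacency alone; in this form it can be carried
  along isomorphisms and checked on the graphs \<open>H_graph\<close>.\<close>

lemma eccn_eq_2_iff:
  assumes "u \<in> pverts G"
  shows "eccn u = 2 \<longleftrightarrow>
    (\<forall>v\<in>pverts G. u = v \<or> adj u v \<or> (\<exists>w. adj u w \<and> adj w v)) \<and>
    (\<exists>v\<in>pverts G. u \<noteq> v \<and> \<not> adj u v)"
proof -
  have "eccn u = 2 \<longleftrightarrow> eccn u \<le> 2 \<and> \<not> eccn u \<le> 1"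
    by auto
  also have "\<dots> \<longleftrightarrow> (\<forall>v\<in>pverts G. hops u v \<le> 2) \<and> (\<exists>v\<in>pverts G. \<not> hops u v \<le> 1)"
    unfolding eccn_le_iff[OF assms] by blast
  finally show ?thesis
    using hops_le_1_iff[OF assms] hops_le_2_iff[OF assms] by simp
qed

lemma eccn_pos:
  assumes "adj u v"
  shows "eccn u \<ge> 1"
proof (rule ccontr)
  assume "\<not> eccn u \<ge> 1"
  then have "hops u v = 0"
    using eccn_le_iff[of u 0] assms adj_in_verts by auto
  then show False
    using assms hops_0_iff adj_in_verts adj_irrefl by blast
qed

text \<open>A vertex of eccentricity 1 is adjacent to all others, so any two vertices are joined
  through it. This is the instance of \<open>\<bar>a - b\<bar> \<le> 1\<close> that
  \<open>abc_weight\<close> consumes.\<close>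

lemma eccn_adj_1:
  assumes "adj u v" "eccn u = 1"
  shows "eccn v \<le> 2"
proof -
  have "\<forall>w\<in>pverts G. u = w \<or> adj u w"
    using eccn_le_iff[of u 1] hops_le_1_iff[of u] assms adj_in_verts by auto
  then show ?thesis
    using assms adj_in_verts adj_sym by (subst eccn_le_iff) (auto simp: hops_le_2_iff)
qed

end

section \<open>The contribution of a single edge\<close>

text \<open>The factors \<open>a - 2\<close> and \<open>b - 2\<close> have opposite signs only if
  one eccentricity is 1 and the other at least 3, which the last two hypotheses exclude. Equality
  means that their product vanishes.\<close>

lemma abc_weight:
  fixes a b :: nat
  assumes "a \<ge> 1" "b \<ge> 1" "a = 1 \<Longrightarrow> b \<le> 2" "b = 1 \<Longrightarrow> a \<le> 2"
  defines "w \<equiv> sqrt ((real a + real b - 2) / (real a * real b))"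
  shows "w \<le> sqrt (1 / 2)" and "w = sqrt (1 / 2) \<longleftrightarrow> a = 2 \<or> b = 2"
proof -
  have pos: "real a * real b > 0"
    using assms by simp
  have *: "(real a + real b - 2) / (real a * real b)
      = 1 / 2 - (real a - 2) * (real b - 2) / (2 * (real a * real b))"
    using assms(1,2) by (simp add: divide_simps) (simp add: algebra_simps)
  have "(real a - 2) * (real b - 2) \<ge> 0"
  proof (cases "a = 1 \<or> b = 1")
    case True
    then show ?thesis using assms by (auto simp: mult_le_0_iff)
  next
    case False
    then have "real a \<ge> 2" "real b \<ge> 2"
      using assms by auto
    then show ?thesis by simp
  qed
  then have "(real a + real b - 2) / (real a * real b) \<le> 1 / 2"
    unfolding * using pos by simp
  then show "w \<le> sqrt (1 / 2)"
    unfolding w_def by simp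
  \<comment> \<open>In HOL \<open>sqrt\<close> is injective on all reals, so comparing the radicands
    suffices.\<close>
  show "w = sqrt (1 / 2) \<longleftrightarrow> a = 2 \<or> b = 2"
    unfolding w_def real_sqrt_eq_iff * using pos by auto
qed

context connected_pair_graph
begin

definition weight :: "'a set \<Rightarrow> real" where
  "weight e = sqrt (((\<Sum>x\<in>e. ecc G x) - 2) / (\<Prod>x\<in>e. ecc G x))"

lemma weight_edge:
  assumes "adj u v"
  shows "weight {u, v} \<le> sqrt (1 / 2)"
    and "weight {u, v} = sqrt (1 / 2) \<longleftrightarrow> eccn u = 2 \<or> eccn v = 2"
proof -
  have "u \<noteq> v"
    using assms adj_irrefl by blast
  then have w: "weight {u, v} =
      sqrt ((real (eccn u) + real (eccn v) - 2) / (real (eccn u) * real (eccn v)))"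
    using adj_in_verts[OF assms] by (simp add: weight_def ecc_eccn)
  note bounds = eccn_pos[OF assms] eccn_pos[OF adj_sym[OF assms]]
    eccn_adj_1[OF assms] eccn_adj_1[OF adj_sym[OF assms]]
  show "weight {u, v} \<le> sqrt (1 / 2)"
    unfolding w by (rule abc_weight(1)[OF bounds])
  show "weight {u, v} = sqrt (1 / 2) \<longleftrightarrow> eccn u = 2 \<or> eccn v = 2"
    unfolding w by (rule abc_weight(2)[OF bounds])
qed

lemma edges_adj: "edges G = {{u, v} | u v. adj u v}"
  by (auto simp: edges_def adj_def image_def)

lemma weight_le: "e \<in> edges G \<Longrightarrow> weight e \<le> sqrt (1 / 2)"
  using weight_edge(1) unfolding edges_adj by blast

lemma finite_edges: "finite (edges G)"
  using pair_finite_arcs by (simp add: edges_def)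

lemma ABC3_weight: "ABC3 G = (\<Sum>e\<in>edges G. weight e)"
  by (simp add: ABC3_def weight_def)

lemma ABC3_le: "ABC3 G \<le> real (card (edges G)) * sqrt (1 / 2)"
  unfolding ABC3_weight by (intro sum_bounded_above weight_le)

text \<open>The deficits \<open>sqrt (1 / 2) - weight e\<close> are nonnegative, so their sum
  vanishes iff each of them does.\<close>

lemma ABC3_eq_iff:
  "ABC3 G = real (card (edges G)) * sqrt (1 / 2) \<longleftrightarrow>
     (\<forall>u v. adj u v \<longrightarrow> eccn u = 2 \<or> eccn v = 2)"
proof -
  have "ABC3 G = real (card (edges G)) * sqrt (1 / 2) \<longleftrightarrow>
      (\<Sum>e\<in>edges G. sqrt (1 / 2) - weight e) = 0"
    by (auto simp: ABC3_weight sum_subtractf)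
  also have "\<dots> \<longleftrightarrow> (\<forall>e\<in>edges G. sqrt (1 / 2) - weight e = 0)"
    using weight_le by (intro sum_nonneg_eq_0_iff finite_edges) (simp only: diff_ge_0_iff_ge)
  also have "\<dots> \<longleftrightarrow> (\<forall>e\<in>edges G. weight e = sqrt (1 / 2))"
    by (metis (no_types, lifting) eq_iff_diff_eq_0)
  also have "\<dots> \<longleftrightarrow> (\<forall>u v. adj u v \<longrightarrow> weight {u, v} = sqrt (1 / 2))"
    unfolding edges_adj by blast
  also have "\<dots> \<longleftrightarrow> (\<forall>u v. adj u v \<longrightarrow> eccn u = 2 \<or> eccn v = 2)"
    using weight_edge(2) by blast
  finally show ?thesis .
qed

end

section \<open>Breadth-first search trees\<close>

lemma pcas_nth: "pcas a q b \<Longrightarrow> Suc i < length q \<Longrightarrow> fst (q ! Suc i) = snd (q ! i)"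
proof (induction q arbitrary: a i)
  case (Cons e q)
  then show ?case
    by (cases i; cases q) auto
qed simp

lemma pcas_ends: "pcas a q b \<Longrightarrow> q \<noteq> [] \<Longrightarrow> fst (hd q) = a \<and> snd (last q) = b"
  by (induction q arbitrary: a) auto

locale rooted_pair_graph = connected_pair_graph +
  fixes r
  assumes root: "r \<in> pverts G"
begin

abbreviation level :: "'a \<Rightarrow> nat" where
  "level \<equiv> hops r"

text \<open>One choice per vertex of a neighbour closer to the root fixes a breadth-first search
  tree. The value at \<open>r\<close> is arbitrary and is kept out of
  \<open>tree_arcs\<close>.\<close>

definition parent :: "'a \<Rightarrow> 'a" where
  "parent v = (SOME w. adj w v \<and> level v = Suc (level w))"

lemma parent:
  assumes "v \<in> pverts G" "v \<noteq> r"
  shows "adj (parent v) v" "level v = Suc (level (parent v))"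
proof -
  obtain k where "level v = Suc k"
    using assms root hops_0_iff by (metis not0_implies_Suc)
  with hops_SucE[OF root assms(1)] have "\<exists>w. adj w v \<and> level v = Suc (level w)"
    by metis
  from someI_ex[OF this] show "adj (parent v) v" "level v = Suc (level (parent v))"
    by (auto simp: parent_def)
qed

definition tree_arcs :: "('a \<times> 'a) set" where
  "tree_arcs = symcl ((\<lambda>v. (v, parent v)) ` (pverts G - {r}))"

lemma tree_arcs_iff:
  "(u, v) \<in> tree_arcs \<longleftrightarrow>
     u \<in> pverts G \<and> u \<noteq> r \<and> v = parent u \<or> v \<in> pverts G \<and> v \<noteq> r \<and> u = parent v"
  by (auto simp: tree_arcs_def symcl_def)

lemma tree_arcs_adj: "(u, v) \<in> tree_arcs \<Longrightarrow> adj u v"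
  by (auto simp: tree_arcs_iff dest: parent adj_sym)

text \<open>In the other orientation \<open>v\<close> would be a child of \<open>u\<close> and lie
  one level farther from the root.\<close>

lemma tree_arcs_parent:
  assumes "(u, v) \<in> tree_arcs" "level v \<le> level u"
  shows "v = parent u"
  using assms parent(2) by (fastforce simp: tree_arcs_iff)

lemma tree_arcs_sym: "(u, v) \<in> tree_arcs \<Longrightarrow> (v, u) \<in> tree_arcs"
  by (auto simp: tree_arcs_iff)

text \<open>Two vertices could share an edge to their parents only by being parents of each other,
  which their levels forbid.\<close>

lemma card_tree_edges:
  "card ((\<lambda>v. {v, parent v}) ` (pverts G - {r})) = card (pverts G) - 1"
proof -
  have "inj_on (\<lambda>v. {v, parent v}) (pverts G - {r})"
  proof (rule inj_onI)
    fix u v assume uv: "u \<in> pverts G - {r}" "v \<in> pverts G - {r}" "{u, parent u} = {v, parent v}"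
    then have "level u = Suc (level (parent u))" "level v = Suc (level (parent v))"
      using parent(2) by auto
    then have "\<not> (u = parent v \<and> parent u = v)"
      by auto
    then show "u = v"
      using uv(3) by (auto simp: doubleton_eq_iff)
  qed
  then show ?thesis
    using root pair_finite_verts by (simp add: card_image)
qed

text \<open>Induction on levels connects every vertex to the root inside the tree, and symmetry then
  connects any two vertices; a walk reduces to a simple path.\<close>

lemma tree_apath:
  assumes "u \<in> pverts G" "v \<in> pverts G"
  obtains p where "apath u p v" "set p \<subseteq> tree_arcs"
proof -
  \<comment> \<open>The tree is made a graph of its own, so that reachability and path extraction
    never leave it.\<close>
  define T where "T = \<lparr>pverts = pverts G, parcs = tree_arcs\<rparr>"
  have "u \<in> pverts G \<and> v \<in> pverts G" if "(u, v) \<in> tree_arcs" for u v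
    using that tree_arcs_adj adj_in_verts by blast
  then interpret T: pair_sym_digraph T
    by unfold_locales (auto simp: T_def symmetric_def sym_def dest: tree_arcs_sym)
  have reach: "r \<rightarrow>\<^sup>*\<^bsub>with_proj T\<^esub> w" if "w \<in> pverts G" for w
    using that
  proof (induction "level w" arbitrary: w)
    case 0
    then have "w = r"
      using hops_0_iff root by metis
    then show ?case
      using root T.reachable_refl by (simp add: T_def)
  next
    case (Suc k)
    then have "w \<noteq> r"
      using hops_0_iff root by fastforce
    note p = parent[OF Suc.prems this]
    have "r \<rightarrow>\<^sup>*\<^bsub>with_proj T\<^esub> parent w"
      using Suc.hyps p adj_in_verts(1) by auto
    moreover have "(parent w, w) \<in> parcs T"
      using Suc.prems \<open>w \<noteq> r\<close> by (simp add: T_def tree_arcs_iff)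
    ultimately show ?case
      by (rule T.reachable_adj_trans)
  qed
  have "u \<rightarrow>\<^sup>*\<^bsub>with_proj T\<^esub> v"
    using T.reachable_trans[OF T.symmetric_reachable'[OF reach[OF assms(1)]] reach[OF assms(2)]] .
  then obtain p where p: "T.apath u p v"
    using T.reachable_apath by blast
  then have "set p \<subseteq> tree_arcs"
    unfolding T.apath_def T.awalk_def by (simp add: T_def)
  moreover have "apath u p v"
    using p calculation assms tree_arcs_adj
    unfolding T.apath_def T.awalk_def apath_def awalk_def by (auto simp: adj_def)
  ultimately show thesis
    by (intro that)
qed

text \<open>The tree path from \<open>x\<close> to \<open>y\<close> is closed by the arc
  \<open>(y, x)\<close>. The last conclusion says that \<open>{x, y}\<close> is the only edge of the
  cycle that may lie outside the tree, which later tells such cycles apart.\<close>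

lemma fundamental_cycle:
  assumes "adj x y" "(x, y) \<notin> tree_arcs"
  obtains C where "C \<in> cycles G" "{x, y} \<in> C"
    "C - {{x, y}} \<subseteq> (\<lambda>(u, v). {u, v}) ` tree_arcs"
proof -
  have xy: "x \<in> pverts G" "y \<in> pverts G" "x \<noteq> y"
    using assms adj_in_verts adj_irrefl by blast+
  obtain p where p: "apath x p y" "set p \<subseteq> tree_arcs"
    using tree_apath xy by blast
  have arc: "(y, x) \<in> parcs G"
    using adj_sym[OF assms(1)] by (simp add: adj_def)
  let ?c = "p @ [(y, x)]"
  have walk: "awalk x p y"
    using p(1) by (simp add: apath_def)
  have ne: "p \<noteq> []"
    using walk xy by (auto simp: awalk_Nil_iff)
  \<comment> \<open>The path has at least two arcs, since a single arc would put
    \<open>(x, y)\<close> into the tree; with the closing arc the length bound of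
    \<open>cycles\<close> is met.\<close>
  have "length p \<noteq> 1"
  proof
    assume "length p = 1"
    then obtain e where "p = [e]"
      by (auto simp: length_Suc_conv)
    then have "p = [(x, y)]"
      using walk by (cases e) (auto simp: awalk_simps)
    then show False
      using p(2) assms(2) by simp
  qed
  with ne have "3 \<le> length ?c"
    by (cases p) (auto simp: neq_Nil_conv)
  moreover have "awalk x ?c x"
    using walk arc xy by (auto simp: awalk_simps)
  \<comment> \<open>Without its first entry, the vertex list of the closed walk is that of the path
    with \<open>x\<close> moved from the front to the end.\<close>
  moreover have "distinct (tl (pawalk_verts x ?c))"
  proof -
    have cas: "pcas x ?c x" "pcas x p y"
      using \<open>awalk x ?c x\<close> walk by (auto simp: awalk_def)
    have "pawalk_verts x ?c = fst (hd ?c) # map snd ?c" "pawalk_verts x p = fst (hd p) # map snd p"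
      using awalk_verts_conv'[OF cas(1)] awalk_verts_conv'[OF cas(2)] ne by simp_all
    moreover have "fst (hd p) = x"
      using cas(2) ne by (cases p) auto
    ultimately show ?thesis
      using p(1) by (auto simp: apath_def)
  qed
  ultimately have "(\<lambda>(u, v). {u, v}) ` set ?c \<in> cycles G"
    unfolding cycles_def cycle_def by blast
  moreover have "{x, y} \<in> (\<lambda>(u, v). {u, v}) ` set ?c"
    by auto
  moreover have "(\<lambda>(u, v). {u, v}) ` set ?c - {{x, y}} \<subseteq> (\<lambda>(u, v). {u, v}) ` tree_arcs"
    using p(2) by auto
  ultimately show thesis ..
qed

lemma tree_arcs_no_cycle:
  assumes "cycle p" "3 \<le> length p"
  shows "\<not> set p \<subseteq> tree_arcs"
proof
  assume tree: "set p \<subseteq> tree_arcs"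
  obtain u where u: "awalk u p u" "distinct (tl (pawalk_verts u p))"
    using assms(1) by (auto simp: cycle_def)
  then have cas: "pcas u p u"
    by (simp add: awalk_def)
  have "pawalk_verts u p = fst (hd p) # map snd p"
    using awalk_verts_conv'[OF cas] assms(2) by auto
  with u have dist: "distinct (map snd p)"
    by simp
  define k where "k = length p"
  have k: "k \<ge> 3"
    using assms by (simp add: k_def)
  \<comment> \<open>Positions count modulo \<open>k\<close>, so the last arc is followed by the
    first.\<close>
  have next_arc: "fst (p ! (Suc i mod k)) = snd (p ! i)" if "i < k" for i
  proof (cases "Suc i = k")
    case True
    have "p \<noteq> []"
      using k by (auto simp: k_def)
    with pcas_ends[OF cas] True show ?thesis
      by (metis diff_Suc_1 hd_conv_nth k_def last_conv_nth mod_self)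
  next
    case False
    then show ?thesis
      using pcas_nth[OF cas] that by (simp add: k_def)
  qed
  \<comment> \<open>A vertex of maximal level on the cycle has its parent as both neighbours.\<close>
  define m where "m = Max ((\<lambda>i. level (snd (p ! i))) ` {..<k})"
  have fin: "finite ((\<lambda>i. level (snd (p ! i))) ` {..<k})" "(\<lambda>i. level (snd (p ! i))) ` {..<k} \<noteq> {}"
    using k by (auto simp: lessThan_empty_iff)
  have "m \<in> (\<lambda>i. level (snd (p ! i))) ` {..<k}"
    unfolding m_def by (rule Max_in[OF fin])
  then obtain j where j: "j < k" "level (snd (p ! j)) = m"
    by auto
  have le: "level (snd (p ! i)) \<le> m" if "i < k" for i
    unfolding m_def using fin(1) that by (intro Max_ge) auto
  \<comment> \<open>Positions \<open>i\<close>, \<open>j\<close>, \<open>l\<close> are cyclically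
    consecutive, with \<open>j\<close> at the maximal level.\<close>
  obtain i where i: "i < k" "Suc i mod k = j"
  proof (cases j)
    case 0
    show thesis
      by (rule that[of "k - 1"]) (use 0 k in auto)
  next
    case (Suc i)
    show thesis
      by (rule that[of i]) (use Suc j in auto)
  qed
  define l where "l = Suc j mod k"
  have l: "l < k"
    using k by (simp add: l_def)
  have arcs: "p ! q \<in> tree_arcs" if "q < k" for q
    using tree that by (auto simp: k_def)
  have "fst (p ! j) = snd (p ! i)"
    using next_arc[OF i(1)] i(2) by simp
  then have "(snd (p ! j), snd (p ! i)) \<in> tree_arcs"
    using arcs[OF j(1)] tree_arcs_sym by (metis prod.collapse)
  then have "snd (p ! i) = parent (snd (p ! j))"
    using tree_arcs_parent le[OF i(1)] j(2) by simp
  moreover have "fst (p ! l) = snd (p ! j)"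
    using next_arc[OF j(1)] by (simp add: l_def)
  then have "(snd (p ! j), snd (p ! l)) \<in> tree_arcs"
    using arcs[OF l] by (metis prod.collapse)
  then have "snd (p ! l) = parent (snd (p ! j))"
    using tree_arcs_parent le[OF l] j(2) by simp
  \<comment> \<open>The heads of the arcs are distinct, so equal neighbours mean equal positions.
    Two steps around the cycle would then return to the start, impossible for
    \<open>k \<ge> 3\<close>.\<close>
  ultimately have "i = l"
    using dist i(1) l by (metis distinct_conv_nth k_def length_map nth_map)
  then have "Suc (Suc i) mod k = i"
    using mod_Suc_eq[of "Suc i" k] i(2) l_def by argo
  then show False
  proof (cases "Suc (Suc i) < k")
    case False
    then have "Suc (Suc i) = k \<or> Suc (Suc i) = Suc k"
      using i(1) by linarith
    with \<open>Suc (Suc i) mod k = i\<close> k show False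
      by (auto simp: mod_Suc)
  qed simp
qed

text \<open>The given cycle cannot lie inside the tree, so a non-tree edge exists. The fundamental
  cycle of a second one would have to coincide with that of the first and so contain
  \<open>{x, y}\<close>, although apart from its own closing edge it consists of tree edges.\<close>

lemma unicyclic_extra_edge:
  assumes "unicyclic G"
  obtains x y where "adj x y" "(x, y) \<notin> tree_arcs"
    "\<forall>u v. adj u v \<longleftrightarrow> (u, v) \<in> tree_arcs \<or> u = x \<and> v = y \<or> u = y \<and> v = x"
proof -
  have uniq: "C = D" if "C \<in> cycles G" "D \<in> cycles G" for C D
    using assms that unfolding unicyclic_def by blast
  have "cycles G \<noteq> {}"
    using assms unfolding unicyclic_def by blast
  then obtain p where p: "cycle p" "3 \<le> length p"
    unfolding cycles_def by blast
  have "set p \<subseteq> parcs G"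
    using p(1) by (auto simp: cycle_def awalk_def)
  with tree_arcs_no_cycle[OF p] obtain x y where xy: "adj x y" "(x, y) \<notin> tree_arcs"
    by (auto simp: adj_def)
  have only: "{u, v} = {x, y}" if uv: "adj u v" "(u, v) \<notin> tree_arcs" for u v
  proof (rule ccontr)
    assume ne: "{u, v} \<noteq> {x, y}"
    obtain C where C: "C \<in> cycles G" "{x, y} \<in> C"
      using fundamental_cycle[OF xy] by metis
    obtain D where D: "D \<in> cycles G" "D - {{u, v}} \<subseteq> (\<lambda>(u, v). {u, v}) ` tree_arcs"
      using fundamental_cycle[OF uv] by metis
    have "{x, y} \<in> D"
      using uniq[OF C(1) D(1)] C(2) by simp
    then have "{x, y} \<in> (\<lambda>(u, v). {u, v}) ` tree_arcs"
      using D(2) ne by blast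
    then show False
      using xy(2) tree_arcs_sym by (auto simp: doubleton_eq_iff)
  qed
  show thesis
  proof (rule that[OF xy], intro allI)
    fix u v
    show "adj u v \<longleftrightarrow> (u, v) \<in> tree_arcs \<or> u = x \<and> v = y \<or> u = y \<and> v = x"
      using only xy tree_arcs_adj adj_sym by (auto simp: doubleton_eq_iff)
  qed
qed

lemma card_edges_unicyclic:
  assumes "unicyclic G"
  shows "card (edges G) = card (pverts G)"
proof -
  obtain x y where xy: "adj x y" "(x, y) \<notin> tree_arcs"
    and adj: "\<forall>u v. adj u v \<longleftrightarrow> (u, v) \<in> tree_arcs \<or> u = x \<and> v = y \<or> u = y \<and> v = x"
    using unicyclic_extra_edge[OF assms] .
  let ?T = "(\<lambda>v. {v, parent v}) ` (pverts G - {r})"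
  have T: "{u, v} \<in> ?T \<longleftrightarrow> (u, v) \<in> tree_arcs" for u v
    unfolding tree_arcs_iff by (auto simp: doubleton_eq_iff)
  have "edges G = insert {x, y} ?T"
  proof (rule set_eqI)
    fix e
    show "e \<in> edges G \<longleftrightarrow> e \<in> insert {x, y} ?T"
    proof
      assume "e \<in> edges G"
      then obtain u v where "e = {u, v}" "adj u v"
        by (auto simp: edges_adj)
      then show "e \<in> insert {x, y} ?T"
        using adj T[of u v] by blast
    next
      assume "e \<in> insert {x, y} ?T"
      then show "e \<in> edges G"
        using xy(1) adj_sym[OF parent(1)] unfolding edges_adj by blast
    qed
  qed
  moreover have "{x, y} \<notin> ?T"
    using T xy by blast
  moreover have "card (pverts G) > 0"
    using root pair_finite_verts by (auto simp: card_gt_0_iff)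
  ultimately show ?thesis
    using card_tree_edges pair_finite_verts by simp
qed

end

section \<open>Isomorphisms onto the graphs \<open>H\<close>\<close>

text \<open>Arcs are pairs of vertices, so the vertex map already determines the arc map.\<close>

lemma digraph_iso_pairI:
  assumes "wf_digraph (with_proj G)" "inj_on f (pverts G)"
    and "pverts H = f ` pverts G" "parcs H = map_prod f f ` parcs G"
  shows "digraph_iso (with_proj G) (with_proj H)"
proof -
  interpret wf_digraph "with_proj G" by fact
  let ?hom = "\<lparr>iso_verts = f, iso_arcs = map_prod f f, iso_head = snd, iso_tail = fst\<rparr>"
  have "parcs G \<subseteq> pverts G \<times> pverts G"
    using wellformed by auto
  then have "inj_on (map_prod f f) (parcs G)"
    using map_prod_inj_on[OF assms(2,2)] inj_on_subset by blast
  then have "digraph_isomorphism ?hom"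
    using assms(1,2) by (simp add: digraph_isomorphism_def)
  moreover have "with_proj H = app_iso ?hom (with_proj G)"
    using assms(3,4) by (simp add: app_iso_def with_proj_def)
  ultimately show ?thesis
    unfolding digraph_iso_def by blast
qed

lemma digraph_iso_pairE:
  assumes "digraph_iso (with_proj G) (with_proj H)"
  obtains f where "inj_on f (pverts G)" "pverts H = f ` pverts G" "parcs H = map_prod f f ` parcs G"
proof -
  obtain hom where hom: "pre_digraph.digraph_isomorphism (with_proj G) hom"
    and H: "with_proj H = app_iso hom (with_proj G)"
    using assms unfolding digraph_iso_def by blast
  let ?f = "iso_verts hom"
  \<comment> \<open>The image is again a pair digraph, which forces the projections of
    \<open>hom\<close> to be the standard ones.\<close>
  have proj: "iso_tail hom = fst" "iso_head hom = snd"
    using H by (auto simp: app_iso_def with_proj_def)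
  have "iso_arcs hom a = map_prod ?f ?f a" if "a \<in> parcs G" for a
    using hom that proj by (auto simp: pre_digraph.digraph_isomorphism_def prod_eq_iff)
  then have "iso_arcs hom ` parcs G = map_prod ?f ?f ` parcs G"
    by (rule image_cong[OF refl])
  moreover have "parcs H = iso_arcs hom ` parcs G" "pverts H = ?f ` pverts G"
    using H by (auto simp: app_iso_def with_proj_def)
  moreover have "inj_on ?f (pverts G)"
    using hom by (simp add: pre_digraph.digraph_isomorphism_def)
  ultimately show thesis
    using that by simp
qed

text \<open>Here \<open>cs\<close> lists the cycle in order, \<open>L\<close> holds the pendent
  vertices, and \<open>h v\<close> is the position on the cycle where \<open>v\<close> hangs. The
  isomorphism sends \<open>cs ! i\<close> to \<open>(i, 0)\<close> and numbers the fibre of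
  \<open>h\<close> over each \<open>i\<close>.\<close>

lemma digraph_iso_H_graph:
  assumes wf: "pair_graph G"
    and "distinct cs" and V: "pverts G = set cs \<union> L" and disj: "set cs \<inter> L = {}"
    and h: "\<And>v. v \<in> L \<Longrightarrow> h v < length cs"
    and A: "parcs G = symcl ({(cs ! i, cs ! (Suc i mod length cs)) | i. i < length cs} \<union>
                        {(cs ! h v, v) | v. v \<in> L})"
  shows "digraph_iso (with_proj G)
    (with_proj (H_graph (map (\<lambda>i. card {v \<in> L. h v = i}) [0..<length cs])))"
proof -
  interpret pair_graph G by fact
  let ?k = "length cs" and ?n = "\<lambda>i. card {v \<in> L. h v = i}"
  have "finite L"
    using V pair_finite_verts by simp
  \<comment> \<open>The numbering starts at 1 because the second coordinate 0 is reserved for cycle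
    vertices.\<close>
  then have "\<exists>b. bij_betw b {v \<in> L. h v = i} {1..?n i}" for i
    by (intro finite_same_card_bij) auto
  then obtain b where b: "\<And>i. bij_betw (b i) {v \<in> L. h v = i} {1..?n i}"
    by metis
  define f where "f v = (if v \<in> L then (h v, b (h v) v) else (THE i. i < ?k \<and> cs ! i = v, 0))" for v
  have fL: "f v = (h v, b (h v) v)" if "v \<in> L" for v
    using that by (simp add: f_def)
  have bL: "b (h v) v \<in> {1..?n (h v)}" if "v \<in> L" for v
    using b[of "h v"] that by (auto simp: bij_betw_def)
  have fC: "f (cs ! i) = (i, 0)" if "i < ?k" for i
  proof -
    have "(THE j. j < ?k \<and> cs ! j = cs ! i) = i"
      using that \<open>distinct cs\<close> by (auto simp: nth_eq_iff_index_eq)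
    moreover have "cs ! i \<notin> L"
      using that disj by (metis IntI empty_iff nth_mem)
    ultimately show ?thesis
      by (simp add: f_def)
  qed
  have f_surj: "\<exists>v\<in>L. h v = i \<and> f v = (i, j)" if "j \<in> {1..?n i}" for i j
  proof -
    have "j \<in> b i ` {v \<in> L. h v = i}"
      using b[of i] that by (simp add: bij_betw_def)
    then show ?thesis
      using fL by auto
  qed
  have inj: "inj_on f (pverts G)"
  proof (rule inj_onI)
    fix u v assume uv: "u \<in> pverts G" "v \<in> pverts G" "f u = f v"
    have snd0: "snd (f w) = 0 \<longleftrightarrow> w \<notin> L" if "w \<in> pverts G" for w
      using bL[of w] by (auto simp: f_def)
    show "u = v"
    proof (cases "u \<in> L")
      case True
      then have "v \<in> L"
        using snd0 uv by metis
      then have "h u = h v" "b (h u) u = b (h u) v"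
        using uv True by (auto simp: fL)
      then show ?thesis
        using b[of "h u"] True \<open>v \<in> L\<close> by (auto simp: bij_betw_def inj_on_def)
    next
      case False
      then have "v \<notin> L"
        using snd0 uv by metis
      then obtain i j where "i < ?k" "u = cs ! i" "j < ?k" "v = cs ! j"
        using uv False V by (auto simp: in_set_conv_nth)
      then show ?thesis
        using uv(3) by (simp add: fC)
    qed
  qed
  let ?H = "H_graph (map ?n [0..<?k])"
  have verts: "pverts ?H = f ` pverts G"
  proof (intro equalityI subsetI)
    fix x assume "x \<in> pverts ?H"
    then obtain i j where x: "x = (i, j)" "i < ?k" "j \<le> ?n i"
      by (auto simp: H_graph_def)
    show "x \<in> f ` pverts G"
    proof (cases "j = 0")
      case True
      then show ?thesis
        using x fC V by (metis UnCI image_eqI nth_mem)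
    next
      case False
      then obtain v where "v \<in> L" "f v = (i, j)"
        using f_surj[of j i] x(3) by auto
      then show ?thesis
        using x(1) V by (metis UnCI image_eqI)
    qed
  next
    fix x assume "x \<in> f ` pverts G"
    then consider i where "i < ?k" "x = f (cs ! i)" | v where "v \<in> L" "x = f v"
      using V by (auto simp: in_set_conv_nth)
    then show "x \<in> pverts ?H"
      using h bL by cases (auto simp: H_graph_def fC fL)
  qed
  have map_symcl: "map_prod f f ` symcl B = symcl (map_prod f f ` B)" for B
    by (force simp: symcl_def)
  have "map_prod f f ` {(cs ! i, cs ! (Suc i mod ?k)) | i. i < ?k} =
      {((i, 0), (Suc i mod ?k, 0)) | i. i < ?k}"
  proof -
    have "map_prod f f ` {(cs ! i, cs ! (Suc i mod ?k)) | i. i < ?k} =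
        (\<lambda>i. (f (cs ! i), f (cs ! (Suc i mod ?k)))) ` {..<?k}"
      unfolding lessThan_def setcompr_eq_image image_image by simp
    also have "\<dots> = (\<lambda>i. ((i, 0), (Suc i mod ?k, 0))) ` {..<?k}"
    proof (intro image_cong refl)
      fix i assume "i \<in> {..<?k}"
      then have "i < ?k" "Suc i mod ?k < ?k"
        by (auto intro: mod_less_divisor)
      then show "(f (cs ! i), f (cs ! (Suc i mod ?k))) = ((i, 0), (Suc i mod ?k, 0))"
        by (simp add: fC)
    qed
    finally show ?thesis
      by auto
  qed
  moreover have "map_prod f f ` {(cs ! h v, v) | v. v \<in> L} =
      {((i, 0::nat), (i, j)) | i j. i < ?k \<and> 1 \<le> j \<and> j \<le> ?n i}" (is "_ = ?P")
  proof (intro equalityI subsetI)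
    fix x assume "x \<in> map_prod f f ` {(cs ! h v, v) | v. v \<in> L}"
    then obtain v where "v \<in> L" "x = (f (cs ! h v), f v)"
      by auto
    then show "x \<in> ?P"
      using h bL by (simp add: fC fL)
  next
    fix x assume "x \<in> ?P"
    then obtain i j where x: "x = ((i, 0), (i, j))" "i < ?k" "1 \<le> j" "j \<le> ?n i"
      by blast
    then obtain v where "v \<in> L" "h v = i" "f v = (i, j)"
      using f_surj[of j i] by auto
    then have "x = map_prod f f (cs ! h v, v)"
      using x by (simp add: fC)
    then show "x \<in> map_prod f f ` {(cs ! h v, v) | v. v \<in> L}"
      using \<open>v \<in> L\<close> by blast
  qed
  moreover have "{((i, 0::nat), (i, j)) | i j. i < ?k \<and> 1 \<le> j \<and> j \<le> map ?n [0..<?k] ! i} =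
      {((i, 0), (i, j)) | i j. i < ?k \<and> 1 \<le> j \<and> j \<le> ?n i}"
    by auto
  ultimately have arcs: "parcs ?H = map_prod f f ` parcs G"
    unfolding A map_symcl by (simp add: H_graph_def image_Un)
  show ?thesis
    by (rule digraph_iso_pairI[OF _ inj verts arcs]) unfold_locales
qed

section \<open>The covering condition: invariance under isomorphism, and validity on the extremal
  graphs\<close>

text \<open>Eccentricity 2 in the form of \<open>eccn_eq_2_iff\<close>, stated outside the locale so
  that it also applies to \<open>H_graph\<close>, free of distances.\<close>

definition ecc_two :: "'a pair_pre_digraph \<Rightarrow> 'a \<Rightarrow> bool" where
  "ecc_two G u \<longleftrightarrow>
     (\<forall>v\<in>pverts G. u = v \<or> (u, v) \<in> parcs G \<or> (\<exists>w. (u, w) \<in> parcs G \<and> (w, v) \<in> parcs G)) \<and>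
     (\<exists>v\<in>pverts G. u \<noteq> v \<and> (u, v) \<notin> parcs G)"

definition ecc_two_cover :: "'a pair_pre_digraph \<Rightarrow> bool" where
  "ecc_two_cover G \<longleftrightarrow> (\<forall>(u, v)\<in>parcs G. ecc_two G u \<or> ecc_two G v)"

text \<open>On vertices of \<open>G\<close> the map \<open>f\<close> both preserves and reflects
  arcs, so adjacency conditions pull back from \<open>H\<close>.\<close>

lemma ecc_two_cover_iso:
  assumes wf: "pair_graph G" and iso: "digraph_iso (with_proj G) (with_proj H)"
    and cover: "ecc_two_cover H"
  shows "ecc_two_cover G"
proof -
  interpret pair_graph G by fact
  obtain f where f: "inj_on f (pverts G)" "pverts H = f ` pverts G" "parcs H = map_prod f f ` parcs G"
    using digraph_iso_pairE[OF iso] .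
  have sub: "u \<in> pverts G \<and> v \<in> pverts G" if "(u, v) \<in> parcs G" for u v
    using that wellformed' by blast
  have arc: "(f u, f v) \<in> parcs H \<longleftrightarrow> (u, v) \<in> parcs G" if "u \<in> pverts G" "v \<in> pverts G" for u v
  proof
    assume "(f u, f v) \<in> parcs H"
    then obtain u' v' where "(u', v') \<in> parcs G" "f u = f u'" "f v = f v'"
      unfolding f(3) by auto
    then show "(u, v) \<in> parcs G"
      using f(1) that sub by (metis inj_onD)
  next
    assume "(u, v) \<in> parcs G"
    then show "(f u, f v) \<in> parcs H"
      unfolding f(3) by force
  qed
  have two: "ecc_two G u" if u: "u \<in> pverts G" and E: "ecc_two H (f u)" for u
  proof -
    have "u = v \<or> (u, v) \<in> parcs G \<or> (\<exists>w. (u, w) \<in> parcs G \<and> (w, v) \<in> parcs G)"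
      if v: "v \<in> pverts G" for v
    proof -
      have "f v \<in> pverts H"
        using v f(2) by simp
      with E consider "f u = f v" | "(f u, f v) \<in> parcs H"
        | w where "(f u, w) \<in> parcs H" "(w, f v) \<in> parcs H"
        unfolding ecc_two_def by blast
      then show ?thesis
      proof cases
        case 1
        then show ?thesis
          using f(1) u v by (simp add: inj_on_def)
      next
        case 2
        then show ?thesis
          using arc u v by blast
      next
        case 3
        \<comment> \<open>The midpoint has a preimage, because every arc of \<open>H\<close> is the
          image of an arc of \<open>G\<close>.\<close>
        then obtain w' where "w = f w'" "w' \<in> pverts G"
          using sub unfolding f(3) by auto
        then show ?thesis
          using 3 arc u v by blast
      qed
    qed
    moreover obtain v where "v \<in> pverts G" "f u \<noteq> f v" "(f u, f v) \<notin> parcs H"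
      using E unfolding ecc_two_def f(2) by blast
    then have "\<exists>v\<in>pverts G. u \<noteq> v \<and> (u, v) \<notin> parcs G"
      using arc[OF u] by metis
    ultimately show ?thesis
      unfolding ecc_two_def by blast
  qed
  show ?thesis
    unfolding ecc_two_cover_def
  proof safe
    fix u v assume uv: "(u, v) \<in> parcs G" and "\<not> ecc_two G v"
    then have "(f u, f v) \<in> parcs H"
      using f(3) by force
    then have "ecc_two H (f u) \<or> ecc_two H (f v)"
      using cover unfolding ecc_two_cover_def by blast
    then show "ecc_two G u"
      using two sub[OF uv] \<open>\<not> ecc_two G v\<close> by blast
  qed
qed

text \<open>The clause \<open>(j = 0) \<noteq> (l = 0)\<close> describes a pendent edge in either
  orientation: exactly one end lies on the cycle.\<close>

lemma parcs_H_graph: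
  "((i, j), (k, l)) \<in> parcs (H_graph ns) \<longleftrightarrow>
     i < length ns \<and> k < length ns \<and>
     (j = 0 \<and> l = 0 \<and> (k = Suc i mod length ns \<or> i = Suc k mod length ns) \<or>
      i = k \<and> j \<le> ns ! i \<and> l \<le> ns ! i \<and> (j = 0) \<noteq> (l = 0))"
proof -
  have "Suc m mod length ns < length ns" if "m < length ns" for m
    using that by (intro mod_less_divisor) auto
  then show ?thesis
    by (auto simp: H_graph_def symcl_def)
qed

lemma parcs_H_graph_3:
  assumes "length ns = 3"
  shows "((i, j), (k, l)) \<in> parcs (H_graph ns) \<longleftrightarrow>
     i < 3 \<and> k < 3 \<and> (j = 0 \<and> l = 0 \<and> i \<noteq> k \<or>
      i = k \<and> j \<le> ns ! i \<and> l \<le> ns ! i \<and> (j = 0) \<noteq> (l = 0))"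
proof -
  have "k = Suc i mod 3 \<or> i = Suc k mod 3 \<longleftrightarrow> i \<noteq> k" if "i < 3" "k < 3"
    using that by (auto simp: mod_Suc)
  then show ?thesis
    unfolding parcs_H_graph assms by blast
qed

text \<open>A triangle vertex has eccentricity 2 once another triangle vertex carries a pendent one.
  The hypothesis \<open>pos\<close> excludes the bare triangle, whose eccentricities are all
  1.\<close>

lemma ecc_two_cover_H_graph_3:
  assumes len: "length ns = 3" and pos: "sum_list ns \<ge> 1"
  shows "ecc_two_cover (H_graph ns)"
proof -
  let ?H = "H_graph ns"
  have V: "(i, j) \<in> pverts ?H \<longleftrightarrow> i < 3 \<and> j \<le> ns ! i" for i j
    by (simp add: H_graph_def len)
  note A = parcs_H_graph_3[OF len]
  obtain i0 where i0: "i0 < 3" "ns ! i0 \<ge> 1"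
  proof -
    have "(\<Sum>i<3. ns ! i) \<noteq> 0"
      using pos len sum_list_sum_nth[of ns] by (simp only: atLeast0LessThan)
    then obtain i where "i \<in> {..<3}" "ns ! i \<noteq> 0"
      by (rule sum.not_neutral_contains_not_neutral)
    then show thesis
      using that[of i] by simp
  qed
  have near: "(i, 0) = (k, l) \<or> ((i, 0), (k, l)) \<in> parcs ?H \<or>
      (\<exists>w. ((i, 0), w) \<in> parcs ?H \<and> (w, (k, l)) \<in> parcs ?H)"
    if "i < 3" "k < 3" "l \<le> ns ! k" for i k l
  proof (cases "l = 0 \<or> i = k")
    case True
    then show ?thesis
      using that by (auto simp: A)
  next
    case False
    then have "((i, 0), (k, 0)) \<in> parcs ?H \<and> ((k, 0), (k, l)) \<in> parcs ?H"
      using that unfolding A by auto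
    then show ?thesis
      by blast
  qed
  have hub: "ecc_two ?H (i, 0)" if "i < 3" "k < 3" "k \<noteq> i" "ns ! k \<ge> 1" for i k
  proof -
    have "(k, 1) \<in> pverts ?H" "((i, 0), (k, 1)) \<notin> parcs ?H"
      using that unfolding A V by auto
    moreover have "(i, 0) \<noteq> (k, 1::nat)"
      by simp
    ultimately show ?thesis
      unfolding ecc_two_def using near that(1) V by (metis surj_pair)
  qed
  \<comment> \<open>Of two distinct triangle vertices, at least one differs from
    \<open>i0\<close>.\<close>
  have cyc: "ecc_two ?H (i, 0) \<or> ecc_two ?H (k, 0)" if "i < 3" "k < 3" "i \<noteq> k" for i k
    using hub[of i i0] hub[of k i0] i0 that by blast
  have pend: "ecc_two ?H (i, 0) \<or> ecc_two ?H (i, j)" if "i < 3" "1 \<le> j" "j \<le> ns ! i" for i j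
  proof (cases "\<exists>k<3. k \<noteq> i \<and> ns ! k \<ge> 1")
    case True
    then show ?thesis
      using hub that(1) by blast
  next
    case False
    \<comment> \<open>All pendent vertices hang at \<open>i\<close>, so \<open>(i, 0)\<close> is
      adjacent to everything and the pendent vertex itself has eccentricity 2.\<close>
    then have 0: "ns ! k = 0" if "k < 3" "k \<noteq> i" for k
      using that by (metis One_nat_def Suc_leI neq0_conv)
    have "(i, j) = (k, l) \<or> ((i, j), (k, l)) \<in> parcs ?H \<or>
        (\<exists>w. ((i, j), w) \<in> parcs ?H \<and> (w, (k, l)) \<in> parcs ?H)" if kl: "k < 3" "l \<le> ns ! k" for k l
    proof (cases "k = i \<and> l = 0 \<or> (i, j) = (k, l)")
      case False
      then have "((i, j), (i, 0)) \<in> parcs ?H \<and> ((i, 0), (k, l)) \<in> parcs ?H"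
        using kl \<open>i < 3\<close> \<open>1 \<le> j\<close> \<open>j \<le> ns ! i\<close> 0[of k] unfolding A
        by (cases "k = i") auto
      then show ?thesis
        by blast
    qed (use \<open>i < 3\<close> \<open>1 \<le> j\<close> \<open>j \<le> ns ! i\<close> in \<open>auto simp: A\<close>)
    moreover obtain k where "k < 3" "k \<noteq> i"
      using that[of "if i = 0 then 1 else 0"] by (auto split: if_splits)
    then have "(k, 0) \<in> pverts ?H" "((i, j), (k, 0)) \<notin> parcs ?H" "(i, j) \<noteq> (k, 0)"
      using that unfolding A V by auto
    ultimately have "ecc_two ?H (i, j)"
      unfolding ecc_two_def using V by (metis surj_pair)
    then show ?thesis ..
  qed
  show ?thesis
    unfolding ecc_two_cover_def
  proof safe
    fix i j k l assume arc: "((i, j), (k, l)) \<in> parcs ?H" and no: "\<not> ecc_two ?H (k, l)"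
    then show "ecc_two ?H (i, j)"
      using cyc[of i k] pend[of i j] pend[of i l] unfolding A by auto
  qed
qed

text \<open>The 4-cycle is bipartite with complete sides, so adjacency on it is a matter of
  parity.\<close>

lemma parcs_H_graph_4:
  "((i, j), (k, l)) \<in> parcs (H_graph [a, 0, 0, 0]) \<longleftrightarrow>
     i < 4 \<and> k < 4 \<and> (j = 0 \<and> l = 0 \<and> odd (i + k) \<or>
       i = 0 \<and> k = 0 \<and> j \<le> a \<and> l \<le> a \<and> (j = 0) \<noteq> (l = 0))"
proof -
  have "k = Suc i mod 4 \<or> i = Suc k mod 4 \<longleftrightarrow> odd (i + k)" if "i < 4" "k < 4"
    using that by (simp add: mod_Suc) presburger
  moreover have "[a, 0, 0, 0] ! i = (if i = 0 then a else 0)" if "i < 4"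
    using that by (auto simp: nth_Cons' less_Suc_eq numeral_eq_Suc)
  moreover have "length [a, 0, 0, 0] = 4"
    by simp
  ultimately show ?thesis
    unfolding parcs_H_graph by (auto split: if_splits)
qed

text \<open>Cycle vertices 0, 1 and 3 have eccentricity 2. The vertex opposite the hub is left out,
  being at distance 3 from any pendent vertex; its neighbours 1 and 3 cover its edges.\<close>

lemma ecc_two_cover_H_graph_4: "ecc_two_cover (H_graph [a, 0, 0, 0])"
proof -
  let ?H = "H_graph [a, 0, 0, 0]"
  have V: "(i, j) \<in> pverts ?H \<longleftrightarrow> i < 4 \<and> j \<le> (if i = 0 then a else 0)" for i j
    by (auto simp: H_graph_def less_Suc_eq split: if_splits)
  note A = parcs_H_graph_4
  have two: "ecc_two ?H (i, 0)" if i: "i \<in> {0, 1, 3}" for i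
  proof -
    have "(i, 0) = (k, l) \<or> ((i, 0), (k, l)) \<in> parcs ?H \<or>
        (\<exists>w. ((i, 0), w) \<in> parcs ?H \<and> (w, (k, l)) \<in> parcs ?H)"
      if kl: "k < 4" "l \<le> (if k = 0 then a else 0)" for k l
    proof (cases "even (i + k)")
      case False
      then have "l = 0 \<Longrightarrow> ((i, 0), (k, l)) \<in> parcs ?H"
        using i kl unfolding A by auto
      moreover have "((i, 0), (0, 0)) \<in> parcs ?H \<and> ((0, 0), (k, l)) \<in> parcs ?H" if "l \<noteq> 0"
        using i kl that False unfolding A by (auto split: if_splits)
      ultimately show ?thesis
        by blast
    next
      case True
      show ?thesis
      proof (cases "l = 0")
        case True
        have "((i, 0), (Suc i mod 4, 0)) \<in> parcs ?H \<and> ((Suc i mod 4, 0), (k, l)) \<in> parcs ?H"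
          using i kl True \<open>even (i + k)\<close> unfolding A by auto
        then show ?thesis
          by blast
      next
        case False
        then have "((i, 0), (k, l)) \<in> parcs ?H"
          using i kl \<open>even (i + k)\<close> unfolding A by (auto split: if_splits)
        then show ?thesis
          by blast
      qed
    qed
    \<comment> \<open>The opposite vertex of the cycle is the non-neighbour.\<close>
    moreover have "((i + 2) mod 4, 0) \<in> pverts ?H" "((i, 0), ((i + 2) mod 4, 0)) \<notin> parcs ?H"
        "(i, 0) \<noteq> ((i + 2) mod 4, 0::nat)"
      using i unfolding A V by auto
    ultimately show ?thesis
      unfolding ecc_two_def using V by (metis surj_pair)
  qed
  show ?thesis
    unfolding ecc_two_cover_def
  proof safe
    fix i j k l assume arc: "((i, j), (k, l)) \<in> parcs ?H" and no: "\<not> ecc_two ?H (k, l)"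
    from arc consider "j = 0" "l = 0" "i < 4" "k < 4" "odd (i + k)"
      | "i = 0" "k = 0" "j = 0" | "i = 0" "k = 0" "l = 0"
      unfolding A by blast
    then show "ecc_two ?H (i, j)"
    proof cases
      case 1
      have "i \<in> {0, 1, 2, 3}" "k \<in> {0, 1, 2, 3}"
        using 1 by auto
      then have "i \<in> {0, 1, 3} \<or> k \<in> {0, 1, 3}"
        using 1(5) by auto
      then show ?thesis
        using two no 1 by blast
    qed (use two[of 0] no in auto)
  qed
qed

section \<open>Unicyclic graphs covered by vertices of eccentricity 2\<close>

lemma symcl_iff: "(u, v) \<in> symcl A \<longleftrightarrow> (u, v) \<in> A \<or> (v, u) \<in> A"
  by (auto simp: symcl_def)

context connected_pair_graph
begin

text \<open>The function \<open>h\<close> names the only neighbour of each vertex off the triangle;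
  the numbers \<open>n1\<close>, \<open>n2\<close>, \<open>n3\<close> are the sizes of its
  fibres.\<close>

lemma iso_H_graph_triangle:
  assumes dist: "a \<noteq> b" "b \<noteq> c" "c \<noteq> a" and adj: "adj a b" "adj b c" "adj c a"
    and hub: "\<And>v. v \<in> pverts G - {a, b, c} \<Longrightarrow> h v \<in> {a, b, c}"
    and pend: "\<And>t v. v \<in> pverts G - {a, b, c} \<Longrightarrow> adj t v \<longleftrightarrow> t = h v"
  shows "\<exists>n1 n2 n3. n1 + n2 + n3 = card (pverts G) - 3 \<and>
    digraph_iso (with_proj G) (with_proj (H_graph [n1, n2, n3]))"
proof -
  let ?cs = "[a, b, c]" and ?L = "pverts G - {a, b, c}"
  define k where "k v = (if h v = a then 0 else if h v = b then 1 else 2::nat)" for v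
  have kh: "k v < 3 \<and> ?cs ! k v = h v" if "v \<in> ?L" for v
  proof -
    have "h v = a \<or> h v = b \<or> h v = c"
      using hub[OF that] by simp
    then show ?thesis
      by (auto simp: k_def)
  qed
  have cyc: "{(?cs ! i, ?cs ! (Suc i mod length ?cs)) | i. i < length ?cs} = {(a, b), (b, c), (c, a)}"
  proof -
    have len: "length ?cs = 3"
      by simp
    have "{(?cs ! i, ?cs ! (Suc i mod length ?cs)) | i. i < length ?cs} =
        (\<lambda>i. (?cs ! i, ?cs ! (Suc i mod 3))) ` {..<3}"
      by (simp only: len setcompr_eq_image lessThan_def)
    also have "{..<3} = {0, 1, 2::nat}"
      by auto
    finally show ?thesis
      by simp
  qed
  have pendent: "{(?cs ! k v, v) | v. v \<in> ?L} = {(h v, v) | v. v \<in> ?L}"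
    using kh by (intro Collect_cong) metis
  have arcs: "parcs G = symcl ({(a, b), (b, c), (c, a)} \<union> {(h v, v) | v. v \<in> ?L})"
  proof (rule set_eqI)
    fix e :: "'a \<times> 'a"
    obtain u v where e: "e = (u, v)" by force
    have "adj u v \<longleftrightarrow> (u, v) \<in> {(a, b), (b, c), (c, a), (b, a), (c, b), (a, c)} \<or>
        v \<in> ?L \<and> u = h v \<or> u \<in> ?L \<and> v = h u"
    proof (cases "u \<in> ?L \<or> v \<in> ?L")
      case True
      then show ?thesis
        using pend[of v u] pend[of u v] hub adj_sym[of u v] adj_sym[of v u] by auto
    next
      case False
      show ?thesis
      proof
        assume uv: "adj u v"
        then have "u \<in> {a, b, c}" "v \<in> {a, b, c}"
          using False adj_in_verts[OF uv] by blast+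
        moreover have "u \<noteq> v"
          using uv adj_irrefl by blast
        ultimately show "(u, v) \<in> {(a, b), (b, c), (c, a), (b, a), (c, b), (a, c)} \<or>
            v \<in> ?L \<and> u = h v \<or> u \<in> ?L \<and> v = h u"
          by auto
      qed (use adj adj[THEN adj_sym] False in auto)
    qed
    also have "\<dots> \<longleftrightarrow> (u, v) \<in> symcl ({(a, b), (b, c), (c, a)} \<union> {(h v, v) | v. v \<in> ?L})"
      unfolding symcl_iff by auto
    finally show "e \<in> parcs G \<longleftrightarrow> e \<in> symcl ({(a, b), (b, c), (c, a)} \<union> {(h v, v) | v. v \<in> ?L})"
      by (simp only: e adj_def)
  qed
  have iso: "digraph_iso (with_proj G)
    (with_proj (H_graph (map (\<lambda>i. card {v \<in> ?L. k v = i}) [0..<length ?cs])))"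
  proof (rule digraph_iso_H_graph)
    show "pair_graph G" ..
    show "pverts G = set ?cs \<union> ?L"
      using adj adj_in_verts by auto
    show "parcs G = symcl ({(?cs ! i, ?cs ! (Suc i mod length ?cs)) |i. i < length ?cs} \<union>
        {(?cs ! k v, v) |v. v \<in> ?L})"
      unfolding cyc pendent by (rule arcs)
    show "k v < length ?cs" if "v \<in> ?L" for v
      using kh[OF that] by simp
  qed (use dist in auto)
  define n where "n i = card {v \<in> ?L. k v = i}" for i
  have *: "map n [0..<length ?cs] = [n 0, n 1, n 2]"
    by (simp add: upt_rec numeral_2_eq_2)
  have iso': "digraph_iso (with_proj G) (with_proj (H_graph [n 0, n 1, n 2]))"
    using iso unfolding n_def[symmetric] * .
  \<comment> \<open>The sum of the three numbers is read off from the isomorphism by counting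
    vertices on both sides.\<close>
  have "card (pverts (H_graph [n 0, n 1, n 2])) = card (pverts G)"
    using digraph_iso_pairE[OF iso'] card_image by metis
  then have "n 0 + n 1 + n 2 = card (pverts G) - 3"
    unfolding card_pverts_H_graph by simp
  then show ?thesis
    using iso' by blast
qed

text \<open>The hub \<open>a\<close> comes first, since the pendent vertices of
  \<open>H_graph [m, 0, 0, 0]\<close> hang at position 0. Unlike in a triangle, the diagonals must
  be excluded to determine the arcs.\<close>

lemma iso_H_graph_square:
  assumes dist: "distinct [a, b, c, d]" and adj: "adj a b" "adj b c" "adj c d" "adj d a"
    and nadj: "\<not> adj a c" "\<not> adj b d"
    and pend: "\<And>t v. v \<in> pverts G - {a, b, c, d} \<Longrightarrow> adj t v \<longleftrightarrow> t = a"
  shows "digraph_iso (with_proj G) (with_proj (H_graph [card (pverts G) - 4, 0, 0, 0]))"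
proof -
  let ?cs = "[a, b, c, d]" and ?L = "pverts G - {a, b, c, d}"
  have cyc: "{(?cs ! i, ?cs ! (Suc i mod length ?cs)) | i. i < length ?cs} =
      {(a, b), (b, c), (c, d), (d, a)}"
  proof -
    have len: "length ?cs = 4"
      by simp
    have "{(?cs ! i, ?cs ! (Suc i mod length ?cs)) | i. i < length ?cs} =
        (\<lambda>i. (?cs ! i, ?cs ! (Suc i mod 4))) ` {..<4}"
      by (simp only: len setcompr_eq_image lessThan_def)
    also have "{..<4} = {0, 1, 2, 3::nat}"
      by auto
    finally show ?thesis
      by simp
  qed
  have pendent: "{(?cs ! 0, v) | v. v \<in> ?L} = {(a, v) | v. v \<in> ?L}"
    by simp
  have arcs: "parcs G = symcl ({(a, b), (b, c), (c, d), (d, a)} \<union> {(a, v) | v. v \<in> ?L})"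
  proof (rule set_eqI)
    fix e :: "'a \<times> 'a"
    obtain u v where e: "e = (u, v)" by force
    have "adj u v \<longleftrightarrow>
        (u, v) \<in> {(a, b), (b, c), (c, d), (d, a), (b, a), (c, b), (d, c), (a, d)} \<or>
        v \<in> ?L \<and> u = a \<or> u \<in> ?L \<and> v = a"
    proof (cases "u \<in> ?L \<or> v \<in> ?L")
      case True
      then show ?thesis
      proof
        assume "v \<in> ?L"
        with pend[OF this, of u] show ?thesis by auto
      next
        assume "u \<in> ?L"
        moreover have "adj u v \<longleftrightarrow> adj v u"
          using adj_sym by blast
        ultimately show ?thesis
          using pend[of u v] by auto
      qed
    next
      case False
      show ?thesis
      proof
        assume uv: "adj u v"
        then have "u \<in> {a, b, c, d}" "v \<in> {a, b, c, d}"
          using False adj_in_verts[OF uv] by blast+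
        moreover have "u \<noteq> v" "(u, v) \<notin> {(a, c), (c, a), (b, d), (d, b)}"
          using uv adj_irrefl adj_sym nadj by blast+
        ultimately show "(u, v) \<in>
            {(a, b), (b, c), (c, d), (d, a), (b, a), (c, b), (d, c), (a, d)} \<or>
            v \<in> ?L \<and> u = a \<or> u \<in> ?L \<and> v = a"
          by auto
      qed (use adj adj[THEN adj_sym] False in auto)
    qed
    also have "\<dots> \<longleftrightarrow>
        (u, v) \<in> symcl ({(a, b), (b, c), (c, d), (d, a)} \<union> {(a, v) | v. v \<in> ?L})"
      unfolding symcl_iff by auto
    finally show "e \<in> parcs G \<longleftrightarrow>
        e \<in> symcl ({(a, b), (b, c), (c, d), (d, a)} \<union> {(a, v) | v. v \<in> ?L})"
      by (simp only: e adj_def)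
  qed
  have iso: "digraph_iso (with_proj G)
    (with_proj (H_graph (map (\<lambda>i. card {v \<in> ?L. 0 = i}) [0..<length ?cs])))"
  proof (rule digraph_iso_H_graph)
    show "pair_graph G" ..
    show "pverts G = set ?cs \<union> ?L"
      using adj adj_in_verts by auto
    show "parcs G = symcl ({(?cs ! i, ?cs ! (Suc i mod length ?cs)) |i. i < length ?cs} \<union>
        {(?cs ! 0, v) |v. v \<in> ?L})"
      unfolding cyc pendent by (rule arcs)
  qed (use dist in auto)
  have "{a, b, c, d} \<subseteq> pverts G"
    using adj adj_in_verts by blast
  then have "card ?L = card (pverts G) - 4"
    using dist by (subst card_Diff_subset) auto
  moreover have "map (\<lambda>i. card {v \<in> ?L. 0 = i}) [0..<length ?cs] = [card ?L, 0, 0, 0]"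
    by (simp add: upt_rec set_diff_eq)
  ultimately show ?thesis
    using iso by (simp only:)
qed

text \<open>On vertices this is \<open>hops u v \<le> 2\<close>, by
  \<open>hops_le_2_iff\<close>.\<close>

definition near :: "'a \<Rightarrow> 'a \<Rightarrow> bool" where
  "near u v \<longleftrightarrow> u = v \<or> adj u v \<or> (\<exists>w. adj u w \<and> adj w v)"

text \<open>The pendent vertex \<open>w\<close> is entered only through \<open>z\<close>. This turns
  the covering condition into restrictions on where pendent vertices hang.\<close>

lemma near_leaf:
  assumes "\<And>t. adj t w \<longleftrightarrow> t = z"
  shows "near u w \<longleftrightarrow> u = w \<or> u = z \<or> adj u z"
  unfolding near_def using assms by auto

end

section \<open>Search trees of depth two with one extra edge\<close>

text \<open>The root stands for a vertex of eccentricity 2, and \<open>xy\<close> is the extra edge.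
  The assumption \<open>cover\<close> keeps the upper half of the covering condition: an end of each
  edge is within distance 2 of all vertices.\<close>

locale depth_two_graph = rooted_pair_graph +
  fixes x y
  assumes depth: "v \<in> pverts G \<Longrightarrow> level v \<le> 2"
    and cover: "adj u v \<Longrightarrow> (\<forall>w\<in>pverts G. near u w) \<or> (\<forall>w\<in>pverts G. near v w)"
    and extra_adj: "adj x y" and extra_not_tree: "(x, y) \<notin> tree_arcs"
    and adj_iff: "adj u v \<longleftrightarrow> (u, v) \<in> tree_arcs \<or> u = x \<and> v = y \<or> u = y \<and> v = x"
begin

lemma level_root: "level r = 0"
  using hops_0_iff[OF root root] by simp

lemma level_0: "v \<in> pverts G \<Longrightarrow> level v = 0 \<Longrightarrow> v = r"
  using hops_0_iff[OF root] by simp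

lemma level_cases:
  assumes "v \<in> pverts G"
  obtains "v = r" | "level v = 1" | "level v = 2"
proof -
  have "level v = 0 \<or> level v = 1 \<or> level v = 2"
    using depth[OF assms] by linarith
  then show thesis
    using level_0[OF assms] that by blast
qed

lemma parent_level_1:
  assumes "v \<in> pverts G" "level v = 1"
  shows "parent v = r"
proof -
  have "v \<noteq> r"
    using assms level_root by auto
  from parent[OF assms(1) this] show ?thesis
    using level_0 adj_in_verts assms(2) by simp
qed

lemma parent_level_2:
  assumes "v \<in> pverts G" "level v = 2"
  shows "level (parent v) = 1" "parent v \<in> pverts G" "adj (parent v) v"
proof -
  have "v \<noteq> r"
    using assms level_root by auto
  from parent[OF assms(1) this] show "level (parent v) = 1" "parent v \<in> pverts G" "adj (parent v) v"
    using adj_in_verts assms(2) by simp_all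
qed

lemma adj_root_level_1:
  assumes "v \<in> pverts G" "level v = 1"
  shows "adj r v"
proof -
  have "v \<noteq> r"
    using assms level_root by auto
  from parent(1)[OF assms(1) this] show ?thesis
    by (simp add: parent_level_1[OF assms])
qed

text \<open>A tree edge joins different levels, so an edge within one level is the extra
  edge.\<close>

lemma adj_level_1_1:
  assumes "level u = 1" "level v = 1" "adj u v"
  shows "u = x \<and> v = y \<or> u = y \<and> v = x"
  using assms parent_level_1 level_root unfolding adj_iff tree_arcs_iff by fastforce

lemma adj_level_1_2:
  assumes "level u = 1" "level v = 2" "adj u v"
  shows "u = parent v \<or> u = x \<and> v = y \<or> u = y \<and> v = x"
  using assms parent_level_1 level_root unfolding adj_iff tree_arcs_iff by fastforce

lemma adj_level_2_2:
  assumes "level u = 2" "level v = 2" "adj u v"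
  shows "u = x \<and> v = y \<or> u = y \<and> v = x"
  using assms parent_level_2(1) unfolding adj_iff tree_arcs_iff by fastforce

lemma adj_root:
  assumes "adj r v"
  shows "level v = 1"
proof -
  have v: "v \<in> pverts G" "v \<noteq> r"
    using assms adj_in_verts adj_irrefl by auto
  have "level v \<le> 1"
    using hops_adj[OF root assms] level_root by simp
  then show ?thesis
    using level_0[OF v(1)] v(2) by (cases "level v = 0") auto
qed

text \<open>Every neighbour of the root has the root as parent, so all edges at the root are tree
  edges and \<open>r\<close> is no end of the extra edge.\<close>

lemma extra_level: "x \<in> pverts G" "y \<in> pverts G" "x \<noteq> y" "level x \<in> {1, 2}" "level y \<in> {1, 2}"
proof -
  show xy: "x \<in> pverts G" "y \<in> pverts G" "x \<noteq> y"
    using extra_adj adj_in_verts adj_irrefl by auto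
  have "x \<noteq> r"
  proof
    assume "x = r"
    then have "parent y = x"
      using adj_root parent_level_1 xy extra_adj by auto
    then show False
      using extra_not_tree xy \<open>x = r\<close> by (auto simp: tree_arcs_iff)
  qed
  then show "level x \<in> {1, 2}"
    using xy(1) by (auto elim: level_cases)
  have "y \<noteq> r"
  proof
    assume "y = r"
    then have "parent x = y"
      using adj_root parent_level_1 xy adj_sym[OF extra_adj] by auto
    then show False
      using extra_not_tree xy \<open>y = r\<close> by (auto simp: tree_arcs_iff)
  qed
  then show "level y \<in> {1, 2}"
    using xy(2) by (auto elim: level_cases)
qed

lemma leaf_level_2:
  assumes "v \<in> pverts G" "level v = 2" "v \<noteq> x" "v \<noteq> y"
  shows "adj t v \<longleftrightarrow> t = parent v"
proof
  assume "adj t v"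
  then have t: "t \<in> pverts G"
    using adj_in_verts by blast
  from t show "t = parent v"
  proof (cases rule: level_cases)
    case 1
    then show ?thesis
      using adj_root[of v] \<open>adj t v\<close> assms(2) by simp
  next
    case 2
    then show ?thesis
      using adj_level_1_2 assms \<open>adj t v\<close> by blast
  next
    case 3
    then show ?thesis
      using adj_level_2_2 assms \<open>adj t v\<close> by blast
  qed
next
  assume "t = parent v"
  then show "adj t v"
    using parent_level_2(3)[OF assms(1,2)] by simp
qed

lemma leaf_level_1:
  assumes "v \<in> pverts G" "level v = 1" "v \<noteq> x" "v \<noteq> y"
    and childless: "\<And>w. w \<in> pverts G \<Longrightarrow> level w = 2 \<Longrightarrow> parent w \<noteq> v"
  shows "adj t v \<longleftrightarrow> t = r"
proof
  assume "adj t v"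
  then have t: "t \<in> pverts G"
    using adj_in_verts by blast
  from t show "t = r"
  proof (cases rule: level_cases)
    case 2
    then show ?thesis
      using adj_level_1_1 assms \<open>adj t v\<close> by blast
  next
    case 3
    then show ?thesis
      using adj_level_1_2[of v t] adj_sym[OF \<open>adj t v\<close>] assms t by metis
  qed
next
  assume "t = r"
  then show "adj t v"
    using adj_root_level_1 assms by simp
qed

text \<open>The cycle is the triangle on \<open>r\<close>, \<open>x\<close>, \<open>y\<close>.
  Covering the edge \<open>xy\<close> forces each vertex of level 2 to hang at \<open>x\<close> or
  \<open>y\<close>, after which every vertex off the triangle is pendent at its parent.\<close>

lemma extra_edge_levels_1_1:
  assumes "level x = 1" "level y = 1"
  shows "\<exists>n1 n2 n3. n1 + n2 + n3 = card (pverts G) - 3 \<and>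
    digraph_iso (with_proj G) (with_proj (H_graph [n1, n2, n3]))"
proof -
  have children: "parent w \<in> {x, y}" if w: "w \<in> pverts G" "level w = 2" for w
  proof -
    have ne: "w \<noteq> x" "w \<noteq> y"
      using w assms by auto
    have "near x w \<or> near y w"
      using cover[OF extra_adj] w by blast
    then have "x = parent w \<or> adj x (parent w) \<or> y = parent w \<or> adj y (parent w)"
      using near_leaf[OF leaf_level_2[OF w ne]] ne by auto
    then show ?thesis
      using adj_level_1_1 parent_level_2(1)[OF w] assms by blast
  qed
  show ?thesis
  proof (rule iso_H_graph_triangle[where h = parent])
    show "r \<noteq> x" "x \<noteq> y" "y \<noteq> r"
      using assms level_root extra_level by auto
    show "adj r x" "adj x y" "adj y r"
      using assms adj_root_level_1 extra_level extra_adj adj_sym by auto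
  next
    fix v assume v: "v \<in> pverts G - {r, x, y}"
    then consider "level v = 1" | "level v = 2"
      by (auto elim: level_cases)
    then show "parent v \<in> {r, x, y}"
      using v children parent_level_1 by cases auto
  next
    fix t v assume v: "v \<in> pverts G - {r, x, y}"
    then consider "level v = 1" | "level v = 2"
      by (auto elim: level_cases)
    then show "adj t v \<longleftrightarrow> t = parent v"
    proof cases
      case 1
      then have "adj t v \<longleftrightarrow> t = r"
        using v children by (intro leaf_level_1) auto
      then show ?thesis
        using 1 v parent_level_1 by auto
    next
      case 2
      then show ?thesis
        using v leaf_level_2 by auto
    qed
  qed
qed

text \<open>The cycle is \<open>r\<close>, \<open>x\<close>, \<open>y\<close>, \<open>q\<close> with
  \<open>q\<close> the parent of \<open>y\<close>. If \<open>y\<close> is within distance 2 of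
  everything, all pendent vertices hang at one of \<open>x\<close> and \<open>q\<close>; otherwise
  \<open>x\<close> and \<open>q\<close> must both be, and all hang at \<open>r\<close>.\<close>

lemma extra_edge_levels_1_2:
  assumes "level x = 1" "level y = 2"
  shows "digraph_iso (with_proj G) (with_proj (H_graph [card (pverts G) - 4, 0, 0, 0]))"
proof -
  define q where "q = parent y"
  note y = extra_level(2) and x = extra_level(1)
  have q: "level q = 1" "q \<in> pverts G" "adj q y"
    using parent_level_2[OF y assms(2)] by (simp_all add: q_def)
  have "q \<noteq> x"
    using extra_not_tree y assms level_root by (auto simp: q_def tree_arcs_iff)
  have dist: "distinct [r, x, y, q]"
    using \<open>q \<noteq> x\<close> assms q level_root by auto
  have adj: "adj r x" "adj x y" "adj y q" "adj q r"
    using adj_root_level_1 x q assms extra_adj adj_sym by auto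
  have nadj: "\<not> adj r y" "\<not> adj x q" "\<not> adj q x"
    using adj_root[of y] adj_level_1_1[of x q] adj_level_1_1[of q x] q assms \<open>q \<noteq> x\<close> by auto
  have leaf: "adj t w \<longleftrightarrow> t = parent w" if "w \<in> pverts G" "level w = 2" "w \<noteq> y" for t w
    using that assms by (intro leaf_level_2) auto
  have near_level_2: "near u w \<longleftrightarrow> u = w \<or> u = parent w \<or> adj u (parent w)"
    if "w \<in> pverts G" "level w = 2" "w \<noteq> y" for u w
    using near_leaf[OF leaf[OF that]] .
  have adj_y: "z = x \<or> z = q" if "adj y z" "level z = 1" for z
    using adj_level_1_2[OF that(2) assms(2) adj_sym[OF that(1)]] by (auto simp: q_def)
  have adj_1: "\<not> adj u z" if "level u = 1" "level z = 1" for u z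
    using adj_level_1_1[OF that] assms that by auto
  show ?thesis
  proof (cases "\<forall>w\<in>pverts G. near y w")
    case True
    \<comment> \<open>The neighbours of \<open>y\<close> are \<open>x\<close> and \<open>q\<close>,
      and no two vertices of level 1 are adjacent, so \<open>y\<close> comes within distance 2 of no
      further vertex of level 1.\<close>
    have level_1: "z = x \<or> z = q" if z: "z \<in> pverts G" "level z = 1" for z
    proof -
      have "near y z"
        using True z by blast
      then have "adj y z \<or> (\<exists>t. adj y t \<and> adj t z)"
        using z assms by (auto simp: near_def)
      then show ?thesis
      proof
        assume "\<exists>t. adj y t \<and> adj t z"
        then obtain t where t: "adj y t" "adj t z" by blast
        have "t \<in> pverts G"
          using t adj_in_verts by blast
        then show ?thesis
        proof (cases rule: level_cases)
          case 1
          then show ?thesis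
            using t nadj adj_sym by blast
        next
          case 2
          then show ?thesis
            using adj_1 t z by blast
        next
          case 3
          then show ?thesis
            using adj_level_2_2[of y t] t assms by auto
        qed
      qed (use adj_y z in auto)
    qed
    have level_2: "parent w = x \<or> parent w = q" if "w \<in> pverts G" "level w = 2" for w
      using parent_level_2[OF that] level_1 by blast
    \<comment> \<open>With pendent vertices on both sides, the edge from \<open>q\<close> to
      \<open>w2\<close> would be uncovered: both of its ends are farther than 2 from
      \<open>w1\<close>.\<close>
    have one_side: "\<not> (parent w1 = x \<and> parent w2 = q)"
      if w: "w1 \<in> pverts G" "level w1 = 2" "w1 \<noteq> y" "w2 \<in> pverts G" "level w2 = 2" "w2 \<noteq> y" for w1 w2
    proof
      assume p: "parent w1 = x \<and> parent w2 = q"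
      have "adj q w2"
        using parent_level_2(3)[OF w(4,5)] p by simp
      then have "near q w1 \<or> near w2 w1"
        using cover w(1) by blast
      then have "q = w1 \<or> q = x \<or> adj q x \<or> w2 = w1 \<or> w2 = x \<or> adj w2 x"
        using near_level_2[OF w(1-3)] p by auto
      moreover have "\<not> adj w2 x"
        using leaf[OF w(4-6), of x] adj_sym p \<open>q \<noteq> x\<close> by blast
      ultimately show False
        using q w assms p \<open>q \<noteq> x\<close> nadj by auto
    qed
    have others: "level v = 2" if "v \<in> pverts G" "v \<noteq> r" "v \<noteq> x" "v \<noteq> q" for v
      using level_cases[OF that(1)] that level_1 by metis
    show ?thesis
    proof (cases "\<exists>w. w \<in> pverts G \<and> level w = 2 \<and> w \<noteq> y \<and> parent w = x")
      case True
      then have px: "parent w = x" if "w \<in> pverts G" "level w = 2" "w \<noteq> y" for w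
        using that one_side level_2 by blast
      show ?thesis
      proof (rule iso_H_graph_square)
        show "distinct [x, y, q, r]"
          using dist by auto
        show "adj x y" "adj y q" "adj q r" "adj r x" "\<not> adj x q" "\<not> adj y r"
          using adj nadj adj_sym by blast+
      next
        fix t v assume "v \<in> pverts G - {x, y, q, r}"
        then show "adj t v \<longleftrightarrow> t = x"
          using leaf[of v t] px[of v] others[of v] by auto
      qed
    next
      case False
      then have pq: "parent w = q" if "w \<in> pverts G" "level w = 2" "w \<noteq> y" for w
        using that level_2 by blast
      show ?thesis
      proof (rule iso_H_graph_square)
        show "distinct [q, y, x, r]"
          using dist by auto
        show "adj q y" "adj y x" "adj x r" "adj r q" "\<not> adj q x" "\<not> adj y r"
          using adj nadj adj_sym by blast+
      next
        fix t v assume "v \<in> pverts G - {q, y, x, r}"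
        then show "adj t v \<longleftrightarrow> t = q"
          using leaf[of v t] pq[of v] others[of v] by auto
      qed
    qed
  next
    case False
    have near: "\<forall>w\<in>pverts G. near x w" "\<forall>w\<in>pverts G. near q w"
      using cover[OF adj(2)] cover[OF adj(3)] False by blast+
    \<comment> \<open>Another vertex of level 2 would be pendent, and to be within distance 2 of
      both \<open>x\<close> and \<open>q\<close> it would need both as its parent.\<close>
    have no_level_2: "w = y" if w: "w \<in> pverts G" "level w = 2" for w
    proof (rule ccontr)
      assume "w \<noteq> y"
      note nl = near_level_2[OF w this] and p1 = parent_level_2(1)[OF w]
      have "x = parent w"
        using near(1) nl[of x] adj_1[OF assms(1) p1] w assms by auto
      moreover have "q = parent w"
        using near(2) nl[of q] adj_1[OF q(1) p1] w q by auto
      ultimately show False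
        using \<open>q \<noteq> x\<close> by simp
    qed
    show ?thesis
    proof (rule iso_H_graph_square)
      show "distinct [r, x, y, q]" by fact
      show "adj r x" "adj x y" "adj y q" "adj q r" "\<not> adj r y" "\<not> adj x q"
        by fact+
    next
      fix t v assume v: "v \<in> pverts G - {r, x, y, q}"
      then have "level v = 1"
        using level_cases[of v] no_level_2 by blast
      moreover have "parent w \<noteq> v" if "w \<in> pverts G" "level w = 2" for w
        using no_level_2[OF that] v by (auto simp: q_def)
      ultimately show "adj t v \<longleftrightarrow> t = r"
        using v by (intro leaf_level_1) auto
    qed
  qed
qed

text \<open>Covering \<open>xy\<close> leaves only the parents of \<open>x\<close> and
  \<open>y\<close> on level 1. If they coincide in \<open>q\<close>, the cycle is the triangle on
  \<open>q\<close>, \<open>x\<close>, \<open>y\<close>, and the root is itself pendent at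
  \<open>q\<close>.\<close>

lemma extra_edge_levels_2_2:
  assumes "level x = 2" "level y = 2" and n: "card (pverts G) \<ge> 6"
  shows "\<exists>n1 n2 n3. n1 + n2 + n3 = card (pverts G) - 3 \<and>
    digraph_iso (with_proj G) (with_proj (H_graph [n1, n2, n3]))"
proof -
  note xV = extra_level(1) and yV = extra_level(2) and xy = extra_level(3)
  note px = parent_level_2[OF xV assms(1)] and py = parent_level_2[OF yV assms(2)]
  have adj_1: "\<not> adj u z" if "level u = 1" "level z = 1" for u z
    using adj_level_1_1[OF that] assms that by auto
  have adj_12: "u = parent v" if "level u = 1" "level v = 2" "adj u v" for u v
    using adj_level_1_2[OF that] assms that(1) by auto
  have level_1: "z = parent x \<or> z = parent y" if z: "z \<in> pverts G" "level z = 1" for z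
  proof -
    have *: "z = parent x \<or> z = parent y" if v: "level v = 2" "v \<in> {x, y}" and "near v z" for v
    proof -
      have "adj v z \<or> (\<exists>t. adj v t \<and> adj t z)"
        using that z by (auto simp: near_def)
      then show ?thesis
      proof
        assume "adj v z"
        then show ?thesis
          using adj_12[OF z(2) v(1)] adj_sym v(2) by blast
      next
        assume "\<exists>t. adj v t \<and> adj t z"
        then obtain t where t: "adj v t" "adj t z" by blast
        have "t \<in> pverts G"
          using t adj_in_verts by blast
        then show ?thesis
        proof (cases rule: level_cases)
          case 1
          then show ?thesis
            using t adj_root[of v] adj_sym v by auto
        next
          case 2
          then show ?thesis
            using adj_1 t z by blast
        next
          case 3
          then have "t \<in> {x, y}"
            using adj_level_2_2[of v t] t v by auto
          then show ?thesis
            using adj_12[OF z(2) 3] t adj_sym by blast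
        qed
      qed
    qed
    show ?thesis
      using cover[OF extra_adj] * z assms(1,2) by blast
  qed
  have eq: "parent x = parent y"
  proof (rule ccontr)
    assume ne: "parent x \<noteq> parent y"
    \<comment> \<open>Distinct parents give a 5-cycle; \<open>card (pverts G) \<ge> 6\<close>
      supplies a further vertex, necessarily pendent on level 2.\<close>
    have "\<not> pverts G \<subseteq> {r, parent x, parent y, x, y}"
    proof
      assume "pverts G \<subseteq> {r, parent x, parent y, x, y}"
      then have "card (pverts G) \<le> card {r, parent x, parent y, x, y}"
        by (intro card_mono) auto
      also have "\<dots> \<le> 5"
        by (rule card_insert_le_m1 | simp)+
      finally show False
        using n by simp
    qed
    then obtain w where w: "w \<in> pverts G" "w \<noteq> r" "w \<noteq> parent x" "w \<noteq> parent y" "w \<noteq> x" "w \<noteq> y"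
      by blast
    then have w2: "level w = 2"
      using level_cases[OF w(1)] level_1 by metis
    note nl = near_leaf[OF leaf_level_2[OF w(1) w2 w(5,6)]]
    \<comment> \<open>If \<open>v\<close> and the pendent \<open>w\<close> have different parents,
      the edge from \<open>parent v\<close> to \<open>v\<close> is uncovered: neither end is within
      distance 2 of \<open>w\<close>. One of \<open>x\<close> and \<open>y\<close> is such a
      \<open>v\<close>.\<close>
    have bad: False if v: "v \<in> pverts G" "level v = 2" "w \<noteq> v" "parent w \<noteq> parent v" for v
    proof -
      note pv = parent_level_2[OF v(1,2)] and pw = parent_level_2[OF w(1) w2]
      have "near (parent v) w \<or> near v w"
        using cover[OF pv(3)] w(1) by blast
      then show False
        using nl[of v] nl[of "parent v"] adj_1[OF pv(1) pw(1)] adj_12[OF pw(1) v(2)] adj_sym v pv pw w2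
        by auto
    qed
    show False
      using bad[OF xV assms(1) w(5)] bad[OF yV assms(2) w(6)] ne by metis
  qed
  define q where "q = parent x"
  have level_1': "z = q" if "z \<in> pverts G" "level z = 1" for z
    using level_1[OF that] eq by (simp add: q_def)
  have q: "q \<in> pverts G" "level q = 1" "adj q x" "adj q y"
    using px py by (simp_all add: q_def eq)
  show ?thesis
  proof (rule iso_H_graph_triangle[where h = "\<lambda>_. q"])
    show "q \<noteq> x" "x \<noteq> y" "y \<noteq> q"
      using assms q xy by auto
    show "adj q x" "adj x y" "adj y q"
      using q extra_adj adj_sym by auto
  next
    fix t v assume v: "v \<in> pverts G - {q, x, y}"
    then have vV: "v \<in> pverts G" by simp
    then show "adj t v \<longleftrightarrow> t = q"
    proof (cases rule: level_cases)
      case 1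
      have "t = q" if "adj t r"
        using adj_root[OF adj_sym[OF that]] adj_in_verts[OF that] level_1' by blast
      then show ?thesis
        using 1 adj_root_level_1 q adj_sym by blast
    next
      case 2
      then show ?thesis
        using level_1' v by blast
    next
      case 3
      then have "parent v = q"
        using parent_level_2[OF vV] level_1' by blast
      then show ?thesis
        using leaf_level_2[OF vV 3] v by auto
    qed
  qed simp
qed

end

section \<open>Combining the cases\<close>

context connected_pair_graph
begin

lemma ecc_two_near:
  "ecc_two G u \<longleftrightarrow> (\<forall>v\<in>pverts G. near u v) \<and> (\<exists>v\<in>pverts G. u \<noteq> v \<and> \<not> adj u v)"
  by (simp add: ecc_two_def near_def adj_def)

lemma eccn_eq_2: "u \<in> pverts G \<Longrightarrow> eccn u = 2 \<longleftrightarrow> ecc_two G u"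
  by (simp add: eccn_eq_2_iff ecc_two_near near_def)

lemma ecc_two_cover_iff:
  "ecc_two_cover G \<longleftrightarrow> (\<forall>u v. adj u v \<longrightarrow> eccn u = 2 \<or> eccn v = 2)"
  using eccn_eq_2 adj_in_verts by (auto simp: ecc_two_cover_def adj_def)

lemma ecc_two_cover_imp_iso:
  assumes uni: "unicyclic G" and cover: "ecc_two_cover G" and n: "card (pverts G) \<ge> 6"
  shows "(\<exists>n1 n2 n3. n1 + n2 + n3 = card (pverts G) - 3 \<and>
      digraph_iso (with_proj G) (with_proj (H_graph [n1, n2, n3]))) \<or>
    digraph_iso (with_proj G) (with_proj (H_graph [card (pverts G) - 4, 0, 0, 0]))"
proof -
  have "pverts G \<noteq> {}"
    using n by auto
  then obtain r0 where "r0 \<in> pverts G" by blast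
  then interpret R0: rooted_pair_graph G r0
    by unfold_locales
  \<comment> \<open>The tree at \<open>r0\<close> serves to produce some edge; one of its ends has
    eccentricity 2 and becomes the root of the actual search.\<close>
  obtain x0 y0 where "adj x0 y0"
    using R0.unicyclic_extra_edge[OF uni] .
  then obtain r where r: "r \<in> pverts G" "eccn r = 2"
    using cover ecc_two_cover_iff adj_in_verts by blast
  then interpret R: rooted_pair_graph G r
    by unfold_locales
  obtain x' y' where xy': "adj x' y'" "(x', y') \<notin> R.tree_arcs"
    and adj': "\<forall>u v. adj u v \<longleftrightarrow> (u, v) \<in> R.tree_arcs \<or> u = x' \<and> v = y' \<or> u = y' \<and> v = x'"
    using R.unicyclic_extra_edge[OF uni] .
  \<comment> \<open>The ends are ordered by level, so that three level patterns remain.\<close>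
  obtain x y where le: "R.level x \<le> R.level y" and xy: "adj x y" "(x, y) \<notin> R.tree_arcs"
    and adj: "\<And>u v. adj u v \<longleftrightarrow> (u, v) \<in> R.tree_arcs \<or> u = x \<and> v = y \<or> u = y \<and> v = x"
  proof (cases "R.level x' \<le> R.level y'")
    case True
    show thesis
      by (rule that[OF True xy']) (use adj' in blast)
  next
    case False
    show thesis
    proof (rule that[of y' x'])
      show "R.level y' \<le> R.level x'" using False by simp
      show "adj y' x'" using xy'(1) by (rule adj_sym)
      show "(y', x') \<notin> R.tree_arcs" using xy'(2) R.tree_arcs_sym by blast
    qed (use adj' in blast)
  qed
  interpret D: depth_two_graph G r x y
  proof unfold_locales
    show "R.level v \<le> 2" if "v \<in> pverts G" for v
      using eccn_le_iff[OF r(1), of 2] r(2) that by simp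
    show "(\<forall>w\<in>pverts G. near u w) \<or> (\<forall>w\<in>pverts G. near v w)" if "adj u v" for u v
    proof -
      have "ecc_two G u \<or> ecc_two G v"
        using cover that by (auto simp: ecc_two_cover_def adj_def)
      then show ?thesis
        unfolding ecc_two_near by blast
    qed
  qed (use xy adj in auto)
  consider "R.level x = 1" "R.level y = 1" | "R.level x = 1" "R.level y = 2"
    | "R.level x = 2" "R.level y = 2"
    using D.extra_level(4,5) le by auto
  then show ?thesis
    using D.extra_edge_levels_1_1 D.extra_edge_levels_1_2 D.extra_edge_levels_2_2 n by cases blast+
qed

end

theorem theorem2p6:
  fixes G :: "'a pair_pre_digraph" and n :: nat
  assumes "pair_graph G"
    and "unicyclic G"
    and "card (pverts G) = n"
    and "n \<ge> 6"
  shows "ABC3 G \<le> real n * sqrt (1 / 2) \<and>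
    (ABC3 G = real n * sqrt (1 / 2) \<longleftrightarrow>
      (\<exists>n1 n2 n3 :: nat. n1 + n2 + n3 = n - 3 \<and>
         digraph_iso (with_proj G) (with_proj (H_graph [n1, n2, n3]))) \<or>
      digraph_iso (with_proj G) (with_proj (H_graph [n - 4, 0, 0, 0])))"
proof -
  interpret pair_graph G by fact
  interpret connected_pair_graph G
    using assms(2) by unfold_locales (simp add: unicyclic_def)
  obtain r where "r \<in> pverts G"
    using assms(3,4) by fastforce
  then interpret rooted_pair_graph G r
    by unfold_locales
  have card: "card (edges G) = n"
    using card_edges_unicyclic[OF assms(2)] assms(3) by simp
  have "ABC3 G = real n * sqrt (1 / 2) \<longleftrightarrow> ecc_two_cover G"
    using ABC3_eq_iff unfolding card ecc_two_cover_iff .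
  \<comment> \<open>From \<open>n \<ge> 6\<close> the sum \<open>n - 3\<close> is positive, as
    \<open>ecc_two_cover_H_graph_3\<close> requires.\<close>
  moreover have "ecc_two_cover G"
    if "n1 + n2 + n3 = n - 3" "digraph_iso (with_proj G) (with_proj (H_graph [n1, n2, n3]))"
    for n1 n2 n3
    using that assms(4) by (intro ecc_two_cover_iso[OF assms(1) that(2)] ecc_two_cover_H_graph_3) auto
  moreover have "ecc_two_cover G"
    if "digraph_iso (with_proj G) (with_proj (H_graph [n - 4, 0, 0, 0]))"
    by (rule ecc_two_cover_iso[OF assms(1) that ecc_two_cover_H_graph_4])
  ultimately show ?thesis
    using ABC3_le ecc_two_cover_imp_iso[OF assms(2)] assms(3,4) unfolding card by blast
qed

end
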